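(* Let $a>0$ and let $k\in C(\mathbb{R}^2\times[0,1],\mathbb{R})$ be a continuous function such that $$0<\inf_{\mathbb{R}^2\times[0,1]}k\le \sup_{\mathbb{R}^2\times[0,1]}k<a^{-1}.$$ Then there is a simple curve $\gamma\in C^2([0,1],\mathbb{R}^2)$ that solves the boundary value problem $$\ddot\gamma(t)=|\dot\gamma(t)|\,k(\gamma(t),t)\,J(\dot\gamma(t))\quad (t\in[0,1]),\qquad \gamma(0)=(a,0),\quad \gamma(1)=(-a,0).$$ If, moreover, $$\frac{\sup_{(x,t)\in\mathbb{R}^2\times[0,1]}k(x,t)}{\sup_{(x,t)\in\mathbb{R}^2\times[0,1]}k(x,t)\,a+1}<\inf_{(x,t)\in\mathbb{R}^2\times[0,1]}k(x,t),$$ then this boundary value problem possesses at least two (distinct) simple solutions $\gamma\in C^2([0,1],\mathbb{R}^2)$.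
   Context: $J:\mathbb{R}^2\to\mathbb{R}^2$ denotes the counterclockwise rotation by $\pi/2$, $J(x,y)=(-y,x)$. A curve $\gamma:[0,1]\to\mathbb{R}^2$ is simple if it is injective. *)

theory Defs
  imports "HOL-Analysis.Analysis"
begin

text \<open>The plane is \<^typ>\<open>real \<times> real\<close>, whose \<^const>\<open>norm\<close> is the Euclidean one.\<close>

definition J :: "real \<times> real \<Rightarrow> real \<times> real" where
  "J = (\<lambda>(x, y). (- y, x))"

text \<open>The derivative relative to \<open>[0,1]\<close>, hence one-sided at the endpoints. Curves are total
  functions on the reals, but everything below depends only on their restriction to \<open>[0,1]\<close>.\<close>

definition vderiv01 :: "(real \<Rightarrow> real \<times> real) \<Rightarrow> real \<Rightarrow> real \<times> real" where
  "vderiv01 \<gamma> t = vector_derivative \<gamma> (at t within {0..1})"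

definition C2_on01 :: "(real \<Rightarrow> real \<times> real) \<Rightarrow> bool" where
  "C2_on01 \<gamma> \<longleftrightarrow>
     \<gamma> differentiable_on {0..1} \<and>
     vderiv01 \<gamma> differentiable_on {0..1} \<and>
     continuous_on {0..1} (vderiv01 (vderiv01 \<gamma>))"

definition bvp_solution ::
  "real \<Rightarrow> ((real \<times> real) \<times> real \<Rightarrow> real) \<Rightarrow> (real \<Rightarrow> real \<times> real) \<Rightarrow> bool" where
  "bvp_solution a k \<gamma> \<longleftrightarrow>
     C2_on01 \<gamma> \<and>
     (\<forall>t\<in>{0..1}. vderiv01 (vderiv01 \<gamma>) t =
        (norm (vderiv01 \<gamma> t) * k (\<gamma> t, t)) *\<^sub>R J (vderiv01 \<gamma> t)) \<and>
     \<gamma> 0 = (a, 0) \<and> \<gamma> 1 = (- a, 0)"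

definition simple_curve :: "(real \<Rightarrow> real \<times> real) \<Rightarrow> bool" where
  "simple_curve \<gamma> \<longleftrightarrow> inj_on \<gamma> {0..1}"

end

theory Submission
  imports Defs "HOL-Complex_Analysis.Great_Picard"
begin

text \<open>A solution has constant speed \<open>c\<close> and velocity \<open>c (cos \<psi>, sin \<psi>)\<close> with \<open>\<psi>' = c k\<close>. Shoot from
  \<open>(a, 0)\<close> with parameters \<open>(\<psi> 0, c)\<close>, replacing the equation by curves made of finitely many circular
  arcs, which depend continuously on the parameters, and pass to the limit with Arzela-Ascoli. If the
  curvature lies in \<open>[m, M]\<close> and \<open>c \<le> pi / M\<close>, the projection of the chord to the tangent at the midpoint
  is at least \<open>(2 / M) sin (c M / 2)\<close>, which exceeds \<open>2 a\<close> for \<open>c\<close> close to \<open>pi / M\<close>. Thus for such \<open>c\<close>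
  the chord, as a function of \<open>\<psi> 0\<close>, winds once around the disc of radius \<open>2 a\<close>; for \<open>c = 0\<close> it lies
  inside the disc, so in between it hits \<open>(- 2 a, 0)\<close>. A curve that has turned by \<open>2 pi\<close> has a chord of
  length at most \<open>2 / m - 2 / M\<close>, which is below \<open>2 a\<close> under the second hypothesis; stopping curves at
  turning \<open>2 pi\<close> therefore yields another solution with \<open>c > pi / M\<close>.\<close>

section \<open>Winding\<close>

text \<open>If \<open>f\<close> moved by pi or more, it would take the value \<open>f u + pi\<close>
  or \<open>f u - pi\<close>, where the cosine has the sign opposite to
  \<open>cos (f u)\<close>.\<close>

lemma cos_pos_oscillation_less_pi:
  fixes f :: "real \<Rightarrow> real"
  assumes "u \<le> v" and f: "continuous_on {u..v} f" and pos: "\<And>x. x \<in> {u..v} \<Longrightarrow> 0 < cos (f x)"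
  shows "\<bar>f v - f u\<bar> < pi"
proof (rule ccontr)
  assume "\<not> \<bar>f v - f u\<bar> < pi"
  then consider "f u + pi \<le> f v" | "f v \<le> f u - pi" by linarith
  then show False
  proof cases
    case 1
    with IVT'[of f u "f u + pi" v] assms obtain x where "x \<in> {u..v}" "f x = f u + pi" by auto
    with pos[of x] pos[of u] \<open>u \<le> v\<close> show False by simp
  next
    case 2
    with IVT2'[of f v "f u - pi" u] assms obtain x where "x \<in> {u..v}" "f x = f u - pi" by auto
    with pos[of x] pos[of u] \<open>u \<le> v\<close> show False by (simp add: cos_diff)
  qed
qed

text \<open>If \<open>P\<close> avoids \<open>- R\<close>, then \<open>P + R\<close> has a
  continuous logarithm on the contractible rectangle, and the winding number about 0 of its loops at
  fixed \<open>s\<close> does not depend on \<open>s\<close>. It is 0 at \<open>s = 0\<close>, where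
  the loop stays in the right half-plane, and 1 at \<open>s = 1\<close>, where the loop stays within
  a right angle of the direction \<open>\<mu>\<close>, which turns once.\<close>

lemma homotopy_from_disc_to_turning_loop_hits:
  fixes P :: "real \<times> real \<Rightarrow> complex" and \<mu> :: "real \<Rightarrow> real"
  assumes P: "continuous_on ({0..2*pi} \<times> {0..1}) P"
    and per: "\<And>s. s \<in> {0..1} \<Longrightarrow> P (2*pi, s) = P (0, s)"
    and R: "0 \<le> R"
    and inner: "\<And>\<theta>. \<theta> \<in> {0..2*pi} \<Longrightarrow> - R < Re (P (\<theta>, 0))"
    and outer: "\<And>\<theta>. \<theta> \<in> {0..2*pi} \<Longrightarrow> R < Re (P (\<theta>, 1) * cis (- \<mu> \<theta>))"
    and \<mu>: "continuous_on {0..2*pi} \<mu>" "\<mu> (2*pi) = \<mu> 0 + 2*pi"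
  shows "\<exists>z\<in>{0..2*pi} \<times> {0..1}. P z = - of_real R"
proof (rule ccontr)
  let ?S = "{0..2*pi} \<times> {0..1::real}"
  assume no: "\<not> ?thesis"
  have "contractible ?S"
    by (intro convex_imp_contractible convex_Times) auto
  moreover have "continuous_on ?S (\<lambda>z. P z + of_real R)"
    by (intro continuous_intros P)
  moreover have "P z + of_real R \<noteq> 0" if "z \<in> ?S" for z
    using no that by (auto simp: add_eq_0_iff2)
  ultimately obtain g where g: "continuous_on ?S g" and gexp: "\<And>z. z \<in> ?S \<Longrightarrow> P z + of_real R = exp (g z)"
    using continuous_logarithm_on_contractible[of ?S "\<lambda>z. P z + of_real R"] by blast
  have comp: "continuous_on A (\<lambda>x. g (f x))" if "continuous_on A f" "f ` A \<subseteq> ?S" for A and f :: "real \<Rightarrow> real \<times> real"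
    using continuous_on_compose2[OF g that] .
  \<comment> \<open>The winding number of the loop at height \<open>s\<close>: an integer, since by
    \<open>per\<close> the loop closes up.\<close>
  define d where "d s = (Im (g (2*pi, s)) - Im (g (0, s))) / (2*pi)" for s
  have d_cont: "continuous_on {0..1} d"
    unfolding d_def by (intro continuous_intros comp) auto
  have d_int: "d s \<in> \<int>" if "s \<in> {0..1}" for s
  proof -
    have "exp (g (2*pi, s)) = exp (g (0, s))"
      using gexp[of "(2*pi, s)"] gexp[of "(0, s)"] per[OF that] that by auto
    then obtain n :: int where "g (2*pi, s) = g (0, s) + (of_int (2*n) * pi) * \<i>"
      by (auto simp: exp_eq)
    then have "d s = of_int n"
      by (simp add: d_def)
    then show ?thesis by simp
  qed
  \<comment> \<open>A continuous function whose distinct values differ by at least 1 is constant on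
    an interval.\<close>
  have "d constant_on {0..1}"
  proof (rule continuous_discrete_range_constant[OF _ d_cont])
    fix x :: real assume x: "x \<in> {0..1}"
    have "1 \<le> norm (d y - d x)" if "y \<in> {0..1}" "d y \<noteq> d x" for y
      using d_int[OF x] d_int[OF that(1)] that(2)
      by (metis Ints_diff Ints_nonzero_abs_ge1 eq_iff_diff_eq_0 real_norm_def)
    then show "\<exists>e>0. \<forall>y. y \<in> {0..1} \<and> d y \<noteq> d x \<longrightarrow> e \<le> norm (d y - d x)"
      by (intro exI[of _ 1]) auto
  qed simp
  then have d01: "d 0 = d 1" by (force simp: constant_on_def)
  have "\<bar>Im (g (2*pi, 0)) - Im (g (0, 0))\<bar> < pi"
  proof (rule cos_pos_oscillation_less_pi[of 0 "2*pi" "\<lambda>\<theta>. Im (g (\<theta>, 0))"])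
    show "continuous_on {0..2*pi} (\<lambda>\<theta>. Im (g (\<theta>, 0)))"
      by (intro continuous_intros comp) auto
    fix \<theta> assume \<theta>: "\<theta> \<in> {0..2*pi}"
    have "Re (P (\<theta>, 0)) + R = exp (Re (g (\<theta>, 0))) * cos (Im (g (\<theta>, 0)))"
      using gexp[of "(\<theta>, 0)"] \<theta> by (auto simp: Re_exp dest!: arg_cong[where f = Re])
    with inner[OF \<theta>] have "0 < exp (Re (g (\<theta>, 0))) * cos (Im (g (\<theta>, 0)))" by linarith
    then show "0 < cos (Im (g (\<theta>, 0)))" by (simp add: zero_less_mult_iff)
  qed simp
  then have "\<bar>d 0\<bar> < 1" by (simp add: d_def)
  with d_int[of 0] have "d 0 = 0" by (auto elim!: Ints_cases)
  have "\<bar>(Im (g (2*pi, 1)) - \<mu> (2*pi)) - (Im (g (0, 1)) - \<mu> 0)\<bar> < pi"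
  proof (rule cos_pos_oscillation_less_pi[of 0 "2*pi" "\<lambda>\<theta>. Im (g (\<theta>, 1)) - \<mu> \<theta>"])
    show "continuous_on {0..2*pi} (\<lambda>\<theta>. Im (g (\<theta>, 1)) - \<mu> \<theta>)"
      by (intro continuous_intros comp \<mu>) auto
    fix \<theta> assume \<theta>: "\<theta> \<in> {0..2*pi}"
    \<comment> \<open>Adding \<open>R\<close> to \<open>P\<close> costs at most \<open>R\<close> in
      the direction \<open>\<mu>\<close>; this is the margin granted by
      \<open>outer\<close>.\<close>
    have "Re (exp (g (\<theta>, 1)) * cis (- \<mu> \<theta>)) = Re (P (\<theta>, 1) * cis (- \<mu> \<theta>)) + R * cos (\<mu> \<theta>)"
      using gexp[of "(\<theta>, 1)"] \<theta> by (simp add: distrib_right flip: gexp)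
    moreover have "- R \<le> R * cos (\<mu> \<theta>)"
      using R mult_left_mono[of "-1" "cos (\<mu> \<theta>)" R] by simp
    ultimately have "0 < Re (exp (g (\<theta>, 1)) * cis (- \<mu> \<theta>))"
      using outer[OF \<theta>] by linarith
    also have "\<dots> = exp (Re (g (\<theta>, 1))) * cos (Im (g (\<theta>, 1)) - \<mu> \<theta>)"
      by (simp add: Re_exp Im_exp cos_diff algebra_simps)
    finally show "0 < cos (Im (g (\<theta>, 1)) - \<mu> \<theta>)" by (simp add: zero_less_mult_iff)
  qed simp
  then have "\<bar>(Im (g (2*pi, 1)) - Im (g (0, 1))) - 2*pi\<bar> < pi"
    using \<mu>(2) by linarith
  then have "\<bar>d 1 - 1\<bar> < 1"
    by (simp add: d_def abs_less_iff field_simps)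
  with d_int[of 1] have "d 1 = 1" by (auto elim!: Ints_cases)
  with d01 \<open>d 0 = 0\<close> show False by simp
qed

section \<open>Positive and negative part of the cosine\<close>

definition cos_pos_integral :: "real \<Rightarrow> real" where
  "cos_pos_integral u = (LBINT y=0..u. max 0 (cos y))"

text \<open>Since \<open>sin\<close> is the integral of \<open>cos\<close>, this is the integral of
  the negative part of the cosine. The pair records separately how far a curve of curvature 1
  advances and retreats as its tangent angle runs to \<open>u\<close>.\<close>

definition cos_neg_integral :: "real \<Rightarrow> real" where
  "cos_neg_integral u = cos_pos_integral u - sin u"

lemma DERIV_cos_pos_integral: "(cos_pos_integral has_real_derivative max 0 (cos u)) (at u)"
proof -
  \<comment> \<open>This interval contains 0 and has \<open>u\<close> in its interior, on whichever
    side of 0 the point \<open>u\<close> lies.\<close>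
  let ?I = "{min 0 (u - 1)..max 0 (u + 1)}"
  have "((\<lambda>u. LBINT y=0..u. max 0 (cos y)) has_vector_derivative max 0 (cos u)) (at u within ?I)"
    unfolding zero_ereal_def
    by (rule interval_integral_FTC2) (auto intro!: continuous_on_max continuous_intros)
  moreover have "at u within ?I = at u"
    by (intro at_within_Icc_at) auto
  ultimately show ?thesis
    by (simp add: cos_pos_integral_def[abs_def] has_real_derivative_iff_has_vector_derivative)
qed

lemma DERIV_cos_neg_integral: "(cos_neg_integral has_real_derivative max 0 (- cos u)) (at u)"
  unfolding cos_neg_integral_def[abs_def]
  by (rule derivative_eq_intros DERIV_cos_pos_integral refl)+ (simp add: max_def)

lemma cos_pos_integral_mono: "u \<le> v \<Longrightarrow> cos_pos_integral u \<le> cos_pos_integral v"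
  by (rule DERIV_nonneg_imp_nondecreasing) (auto intro: DERIV_cos_pos_integral)

lemma cos_neg_integral_mono: "u \<le> v \<Longrightarrow> cos_neg_integral u \<le> cos_neg_integral v"
  by (rule DERIV_nonneg_imp_nondecreasing) (auto intro: DERIV_cos_neg_integral)

lemma cos_neg_integral_half_pi:
  assumes "\<bar>u\<bar> \<le> pi/2"
  shows "cos_neg_integral u = cos_neg_integral (- (pi/2))"
proof (rule antisym)
  have "cos_neg_integral (pi/2) = cos_neg_integral (- (pi/2))"
  proof (rule DERIV_isconst_end[of "- (pi/2)" "pi/2" cos_neg_integral])
    show "continuous_on {- (pi/2)..pi/2} cos_neg_integral"
      by (meson DERIV_cos_neg_integral DERIV_isCont continuous_at_imp_continuous_on)
    show "(cos_neg_integral has_real_derivative 0) (at x)" if "- (pi/2) < x" "x < pi/2" for x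
      using DERIV_cos_neg_integral[of x] cos_gt_zero_pi[OF that] by (simp add: max_def)
  qed simp
  then show "cos_neg_integral u \<le> cos_neg_integral (- (pi/2))"
    using cos_neg_integral_mono[of u "pi/2"] assms by linarith
qed (use cos_neg_integral_mono assms in auto)

lemma cos_pos_integral_half_pi:
  assumes "pi/2 \<le> u" "u \<le> 3*pi/2"
  shows "cos_pos_integral u = cos_pos_integral (pi/2)"
proof (rule antisym)
  have "cos_pos_integral (3*pi/2) = cos_pos_integral (pi/2)"
  proof (rule DERIV_isconst_end[of "pi/2" "3*pi/2" cos_pos_integral])
    show "continuous_on {pi/2..3*pi/2} cos_pos_integral"
      by (meson DERIV_cos_pos_integral DERIV_isCont continuous_at_imp_continuous_on)
    show "(cos_pos_integral has_real_derivative 0) (at x)" if "pi/2 < x" "x < 3*pi/2" for x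
      using DERIV_cos_pos_integral[of x] cos_gt_zero_pi[of "x - pi"] that
      by (simp add: max_def cos_diff)
  qed simp
  then show "cos_pos_integral u \<le> cos_pos_integral (pi/2)"
    using cos_pos_integral_mono[of u "3*pi/2"] assms by linarith
qed (use cos_pos_integral_mono assms in auto)

text \<open>By periodicity of the cosine the increment over a full turn is independent of the
  starting angle. From \<open>-(pi/2)\<close> it is the integral of the cosine over its positive
  arch, which is 2.\<close>

lemma cos_pos_integral_period: "cos_pos_integral (u + 2*pi) = cos_pos_integral u + 2"
proof -
  have "((\<lambda>u. cos_pos_integral (u + 2*pi) - cos_pos_integral u) has_real_derivative 0) (at u)" for u
    by (rule derivative_eq_intros DERIV_cos_pos_integral DERIV_shift[THEN iffD1] | simp add: DERIV_shift cos_add)+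
  then have "cos_pos_integral (u + 2*pi) - cos_pos_integral u
      = cos_pos_integral (-(pi/2) + 2*pi) - cos_pos_integral (-(pi/2))"
    using DERIV_isconst_all by blast
  also have "\<dots> = cos_pos_integral (pi/2) - cos_pos_integral (-(pi/2))"
    by (subst cos_pos_integral_half_pi) auto
  also have "\<dots> = 2"
    using cos_neg_integral_half_pi[of "pi/2"] by (simp add: cos_neg_integral_def)
  finally show ?thesis by simp
qed

lemma cos_neg_integral_period: "cos_neg_integral (u + 2*pi) = cos_neg_integral u + 2"
  by (simp add: cos_neg_integral_def cos_pos_integral_period)

section \<open>Limits of functions on grids\<close>

text \<open>For \<open>u \<ge> 0\<close>, \<open>ramp (u - real j)\<close> is the length of the part
  of \<open>[0, u]\<close> in the cell \<open>[j, j + 1]\<close>, hence the weight of the j-th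
  increment in a linear interpolation.\<close>

definition ramp :: "real \<Rightarrow> real" where
  "ramp u = max 0 (min 1 u)"

lemma sum_ramp: "0 \<le> u \<Longrightarrow> (\<Sum>j<n. ramp (u - real j)) = min u (real n)"
proof (induction n)
  case (Suc n)
  then show ?case by (auto simp: ramp_def)
qed simp

text \<open>Writing the interpolant as a sum of ramps times increments avoids locating the cell of
  \<open>t\<close>: from \<open>s\<close> to \<open>t\<close> all weights grow, and their total
  growth is \<open>n * (t - s)\<close>.\<close>

lemma piecewise_linear_interpolation:
  fixes x :: "nat \<Rightarrow> 'a::real_normed_vector"
  assumes n: "0 < n" and L: "0 \<le> L" and step: "\<And>j. j < n \<Longrightarrow> norm (x (Suc j) - x j) \<le> L / real n"
  shows "\<exists>f. L-lipschitz_on {0..1} f \<and> (\<forall>j\<le>n. f (real j / real n) = x j)"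
proof -
  define f where "f t = x 0 + (\<Sum>j<n. ramp (real n * t - real j) *\<^sub>R (x (Suc j) - x j))" for t
  have le: "norm (f t - f s) \<le> L * (t - s)" if st: "0 \<le> s" "s \<le> t" "t \<le> 1" for s t
  proof -
    let ?d = "\<lambda>j. ramp (real n * t - real j) - ramp (real n * s - real j)"
    have "real n * s \<le> real n * t" "real n * t \<le> real n * 1"
      using st by (intro mult_left_mono; simp)+
    have d: "0 \<le> ?d j" for j
      using \<open>real n * s \<le> real n * t\<close> by (auto simp: ramp_def)
    have "f t - f s = (\<Sum>j<n. ?d j *\<^sub>R (x (Suc j) - x j))"
      by (simp add: f_def scaleR_diff_left sum_subtractf)
    also have "norm \<dots> \<le> (\<Sum>j<n. ?d j * (L / real n))"
    proof (intro sum_norm_le)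
      fix j assume "j \<in> {..<n}"
      with mult_left_mono[OF step[of j] d[of j]] d[of j]
      show "norm (?d j *\<^sub>R (x (Suc j) - x j)) \<le> ?d j * (L / real n)" by simp
    qed
    also have "\<dots> = ((\<Sum>j<n. ramp (real n * t - real j)) - (\<Sum>j<n. ramp (real n * s - real j))) * (L / real n)"
      by (simp only: sum_distrib_right sum_subtractf[symmetric])
    also have "\<dots> = (real n * t - real n * s) * (L / real n)"
      using st \<open>real n * s \<le> real n * t\<close> \<open>real n * t \<le> real n * 1\<close> by (simp add: sum_ramp min_def)
    also have "\<dots> = L * (t - s)"
      using n by (simp add: field_simps)
    finally show ?thesis .
  qed
  have "L-lipschitz_on {0..1} f"
  proof (rule lipschitz_onI[OF _ L])
    fix s t :: real assume "s \<in> {0..1}" "t \<in> {0..1}"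
    then show "dist (f s) (f t) \<le> L * dist s t"
      using le[of s t] le[of t s] by (cases "s \<le> t") (auto simp: dist_norm norm_minus_commute)
  qed
  moreover have "f (real i / real n) = x i" if "i \<le> n" for i
  proof -
    \<comment> \<open>At the grid point \<open>i\<close> the ramp is 1 for the cells before
      \<open>i\<close> and 0 for all others.\<close>
    have "(\<Sum>j<n. ramp (real i - real j) *\<^sub>R (x (Suc j) - x j)) = (\<Sum>j<i. x (Suc j) - x j)"
      using that by (intro sum.mono_neutral_cong_right) (auto simp: ramp_def)
    also have "\<dots> = x i - x 0" by (rule sum_lessThan_telescope)
    finally show ?thesis using n by (simp add: f_def)
  qed
  ultimately show ?thesis by blast
qed

lemma norm_telescope_le:
  fixes x :: "nat \<Rightarrow> 'a::real_normed_vector"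
  assumes "i \<le> l" and "\<And>j. \<lbrakk>i \<le> j; j < l\<rbrakk> \<Longrightarrow> norm (x (Suc j) - x j - v) \<le> e"
  shows "norm (x l - x i - (real l - real i) *\<^sub>R v) \<le> (real l - real i) * e"
  using assms
proof (induction l rule: dec_induct)
  case (step l)
  have "x (Suc l) - x i - (real (Suc l) - real i) *\<^sub>R v
      = (x l - x i - (real l - real i) *\<^sub>R v) + (x (Suc l) - x l - v)"
    by (simp add: algebra_simps)
  also have "norm \<dots> \<le> (real l - real i) * e + e"
    using step by (intro norm_triangle_mono) auto
  finally show ?case by (simp add: algebra_simps)
qed simp

lemma LIMSEQ_floor_grid:
  fixes n :: "nat \<Rightarrow> nat"
  assumes n: "filterlim n at_top sequentially" and "0 \<le> s"
  shows "(\<lambda>i. real (nat \<lfloor>real (n i) * s\<rfloor>) / real (n i)) \<longlonglongrightarrow> s"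
proof (rule tendsto_sandwich)
  have nr: "filterlim (\<lambda>i. real (n i)) at_top sequentially"
    using n by (rule filterlim_compose[OF filterlim_real_sequentially])
  have ev: "\<forall>\<^sub>F i in sequentially. 0 < n i"
    by (rule eventually_compose_filterlim[OF eventually_gt_at_top n])
  show "\<forall>\<^sub>F i in sequentially. s - 1 / real (n i) \<le> real (nat \<lfloor>real (n i) * s\<rfloor>) / real (n i)"
    using ev
  proof eventually_elim
    case (elim i)
    have "real (n i) * s - 1 \<le> real (nat \<lfloor>real (n i) * s\<rfloor>)" by linarith
    moreover have "s - 1 / real (n i) = (real (n i) * s - 1) / real (n i)"
      using elim by (simp add: field_simps)
    ultimately show ?case by (simp add: divide_right_mono)
  qed
  show "\<forall>\<^sub>F i in sequentially. real (nat \<lfloor>real (n i) * s\<rfloor>) / real (n i) \<le> s"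
    using ev
  proof eventually_elim
    case (elim i)
    have "real (nat \<lfloor>real (n i) * s\<rfloor>) \<le> real (n i) * s" using \<open>0 \<le> s\<close> by simp
    with elim show ?case by (simp add: field_simps)
  qed
  have "(\<lambda>i. 1 / real (n i)) \<longlonglongrightarrow> 0"
    by (rule tendsto_divide_0[OF tendsto_const]) (use nr filterlim_at_top_imp_at_infinity in blast)
  then show "(\<lambda>i. s - 1 / real (n i)) \<longlonglongrightarrow> s"
    using tendsto_diff[OF tendsto_const[of s]] by fastforce
qed simp

text \<open>The one-step errors near \<open>t\<close> are at most \<open>e / n\<close>. Summed over
  the steps between grid points close to \<open>r\<close> and \<open>s\<close> they give about
  \<open>e * (s - r)\<close>, a bound that survives the limit; the \<open>f i\<close> themselves
  need no derivative.\<close>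

lemma has_vector_derivative_limit_of_grid_functions:
  fixes f :: "nat \<Rightarrow> real \<Rightarrow> 'a::real_normed_vector" and n :: "nat \<Rightarrow> nat"
  assumes n: "filterlim n at_top sequentially"
    and lip: "\<And>i. L-lipschitz_on {0..1} (f i)"
    and lim: "\<And>s. s \<in> {0..1} \<Longrightarrow> (\<lambda>i. f i s) \<longlonglongrightarrow> g s"
    and t: "t \<in> {0..1}"
    and incr: "\<And>e. 0 < e \<Longrightarrow> \<exists>d>0. \<forall>\<^sub>F i in sequentially. \<forall>j<n i. \<bar>real j / real (n i) - t\<bar> < d \<longrightarrow>
      norm (f i (real (Suc j) / real (n i)) - f i (real j / real (n i)) - (1 / real (n i)) *\<^sub>R V)
        \<le> e / real (n i)"
  shows "(g has_vector_derivative V) (at t within {0..1})"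
proof -
  have ev: "\<forall>\<^sub>F i in sequentially. 0 < n i"
    by (rule eventually_compose_filterlim[OF eventually_gt_at_top n])
  \<comment> \<open>An estimate for both endpoints near \<open>t\<close>; setting
    \<open>r = t\<close> or \<open>s = t\<close> gives the derivative from the right or from the
    left.\<close>
  have main: "\<exists>d>0. \<forall>r s. 0 \<le> r \<and> r \<le> s \<and> s \<le> 1 \<and> \<bar>r - t\<bar> < d \<and> \<bar>s - t\<bar> < d \<longrightarrow>
      norm (g s - g r - (s - r) *\<^sub>R V) \<le> e * (s - r)" if e: "0 < e" for e
  proof -
    obtain d where d: "0 < d" and incr_d: "\<forall>\<^sub>F i in sequentially. \<forall>j<n i. \<bar>real j / real (n i) - t\<bar> < d \<longrightarrow>
      norm (f i (real (Suc j) / real (n i)) - f i (real j / real (n i)) - (1 / real (n i)) *\<^sub>R V)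
        \<le> e / real (n i)"
      using incr[OF e] by blast
    have "norm (g s - g r - (s - r) *\<^sub>R V) \<le> e * (s - r)"
      if rs: "0 \<le> r" "r \<le> s" "s \<le> 1" "\<bar>r - t\<bar> < d" "\<bar>s - t\<bar> < d" for r s
    proof -
      \<comment> \<open>\<open>G u i\<close> is the last point of the i-th grid that is not beyond
        \<open>u\<close>.\<close>
      define N where "N u i = nat \<lfloor>real (n i) * u\<rfloor>" for u i
      define G where "G u i = real (N u i) / real (n i)" for u i
      have G_lim: "G u \<longlonglongrightarrow> u" if "u \<in> {0..1}" for u
        unfolding G_def N_def using LIMSEQ_floor_grid[OF n] that by simp
      have G_01: "G u i \<in> {0..1}" if "u \<in> {0..1}" for u i
      proof -
        have "real (n i) * u \<le> real (n i)" using that by (simp add: mult_left_le)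
        then have "N u i \<le> n i" unfolding N_def by linarith
        then show ?thesis by (auto simp: G_def divide_le_eq)
      qed
      \<comment> \<open>The evaluation point moves with \<open>i\<close>; the common Lipschitz
        constant makes this harmless.\<close>
      have f_lim: "(\<lambda>i. f i (G u i)) \<longlonglongrightarrow> g u" if u: "u \<in> {0..1}" for u
      proof -
        have "(\<lambda>i. L * \<bar>G u i - u\<bar>) \<longlonglongrightarrow> L * \<bar>u - u\<bar>"
          by (intro tendsto_intros G_lim u)
        then have "(\<lambda>i. L * \<bar>G u i - u\<bar>) \<longlonglongrightarrow> 0" by simp
        moreover have "norm (f i (G u i) - f i u) \<le> L * \<bar>G u i - u\<bar>" for i
          using lipschitz_onD[OF lip[of i] G_01[OF u, of i] u] by (simp add: dist_norm)
        then have "\<forall>\<^sub>F i in sequentially. norm (f i (G u i) - f i u) \<le> L * \<bar>G u i - u\<bar>"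
          by (simp add: always_eventually)
        ultimately have "(\<lambda>i. f i (G u i) - f i u) \<longlonglongrightarrow> 0"
          by (rule Lim_null_comparison[rotated])
        from tendsto_add[OF this lim[OF u]] show ?thesis by simp
      qed
      have "\<forall>\<^sub>F i in sequentially. \<bar>G u i - t\<bar> < d" if "u \<in> {0..1}" "\<bar>u - t\<bar> < d" for u
      proof -
        have "(\<lambda>i. \<bar>G u i - t\<bar>) \<longlonglongrightarrow> \<bar>u - t\<bar>"
          by (intro tendsto_intros G_lim that)
        then show ?thesis using that(2) by (rule order_tendstoD)
      qed
      then have "\<forall>\<^sub>F i in sequentially. \<bar>G r i - t\<bar> < d" "\<forall>\<^sub>F i in sequentially. \<bar>G s i - t\<bar> < d"
        using rs by auto
      with incr_d ev have "\<forall>\<^sub>F i in sequentially.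
        norm (f i (G s i) - f i (G r i) - (G s i - G r i) *\<^sub>R V) \<le> e * (G s i - G r i)"
      proof eventually_elim
        case (elim i)
        have "real (n i) * r \<le> real (n i) * s" "real (n i) * s \<le> real (n i)"
          using rs by (auto intro: mult_left_mono simp: mult_left_le)
        then have N: "N r i \<le> N s i" "N s i \<le> n i"
          unfolding N_def by linarith+
        have "norm (f i (real (N s i) / real (n i)) - f i (real (N r i) / real (n i))
            - (real (N s i) - real (N r i)) *\<^sub>R ((1 / real (n i)) *\<^sub>R V))
          \<le> (real (N s i) - real (N r i)) * (e / real (n i))"
        proof (rule norm_telescope_le[where x = "\<lambda>j. f i (real j / real (n i))", OF N(1)])
          fix j assume j: "N r i \<le> j" "j < N s i"
          have "G r i \<le> real j / real (n i)" "real j / real (n i) \<le> G s i"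
            using j elim(2) by (auto simp: G_def intro!: divide_right_mono)
          with elim have "\<bar>real j / real (n i) - t\<bar> < d" by linarith
          with elim(1) j N show "norm (f i (real (Suc j) / real (n i)) - f i (real j / real (n i))
              - (1 / real (n i)) *\<^sub>R V) \<le> e / real (n i)"
            by auto
        qed
        then show ?case by (simp add: G_def diff_divide_distrib right_diff_distrib mult.commute)
      qed
      moreover have "(\<lambda>i. norm (f i (G s i) - f i (G r i) - (G s i - G r i) *\<^sub>R V))
          \<longlonglongrightarrow> norm (g s - g r - (s - r) *\<^sub>R V)"
        using rs by (intro tendsto_intros f_lim G_lim) auto
      moreover have "(\<lambda>i. e * (G s i - G r i)) \<longlonglongrightarrow> e * (s - r)"
        using rs by (intro tendsto_intros G_lim) auto
      ultimately show ?thesis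
        by (intro tendsto_le[OF trivial_limit_sequentially, rotated])
    qed
    with d show ?thesis by blast
  qed
  show ?thesis
    unfolding has_vector_derivative_def has_derivative_within_alt
  proof (intro conjI allI impI)
    fix e :: real assume "0 < e"
    from main[OF this] obtain d where "0 < d"
      and d: "\<And>r s. \<lbrakk>0 \<le> r; r \<le> s; s \<le> 1; \<bar>r - t\<bar> < d; \<bar>s - t\<bar> < d\<rbrakk>
        \<Longrightarrow> norm (g s - g r - (s - r) *\<^sub>R V) \<le> e * (s - r)" by blast
    have "norm (g y - g t - (y - t) *\<^sub>R V) \<le> e * norm (y - t)" if "y \<in> {0..1}" "norm (y - t) < d" for y
    proof (cases "t \<le> y")
      case True
      then show ?thesis using d[of t y] that t \<open>0 < d\<close> by auto
    next
      case False
      moreover have "g y - g t - (y - t) *\<^sub>R V = - (g t - g y - (t - y) *\<^sub>R V)"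
        by (simp add: algebra_simps)
      ultimately show ?thesis using d[of y t] that t \<open>0 < d\<close> by (simp only: norm_minus_cancel) auto
    qed
    with \<open>0 < d\<close> show "\<exists>d>0. \<forall>y\<in>{0..1}. norm (y - t) < d \<longrightarrow>
        norm (g y - g t - (y - t) *\<^sub>R V) \<le> e * norm (y - t)" by blast
  qed (rule bounded_linear_scaleR_left)
qed

section \<open>Discrete shooting\<close>

text \<open>Each side is the integral over \<open>[0, \<tau>]\<close> of the cosine of a tangent
  angle. The angle of the arc with curvature \<open>M\<close> stays ahead, and both lie in
  \<open>[0, pi]\<close>, where the cosine decreases.\<close>

lemma arc_projection_ge:
  fixes u v \<tau> \<kappa> M :: real
  assumes "0 \<le> u" "u \<le> v" "0 \<le> \<tau>" "0 < \<kappa>" "\<kappa> \<le> M" "v + M * \<tau> \<le> pi"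
  shows "(sin (v + M * \<tau>) - sin v) / M \<le> (sin (u + \<kappa> * \<tau>) - sin u) / \<kappa>"
proof -
  define f where "f x = (sin (u + \<kappa> * x) - sin u) / \<kappa> - (sin (v + M * x) - sin v) / M" for x
  have "f 0 \<le> f \<tau>"
  proof (rule DERIV_nonneg_imp_nondecreasing[OF assms(3)])
    fix x assume x: "0 \<le> x" "x \<le> \<tau>"
    have "(f has_real_derivative cos (u + \<kappa> * x) - cos (v + M * x)) (at x)"
      unfolding f_def using assms(4,5) by (auto intro!: derivative_eq_intros simp: field_simps)
    moreover have "0 \<le> \<kappa> * x" "\<kappa> * x \<le> M * x" "M * x \<le> M * \<tau>"
      using x assms by (auto intro: mult_right_mono mult_left_mono)
    then have "0 \<le> u + \<kappa> * x" "u + \<kappa> * x \<le> v + M * x" "v + M * x \<le> pi"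
      using assms by linarith+
    then have "cos (v + M * x) \<le> cos (u + \<kappa> * x)"
      by (intro cos_monotone_0_pi_le)
    ultimately show "\<exists>y. (f has_real_derivative y) (at x) \<and> 0 \<le> y"
      by (intro exI[of _ "cos (u + \<kappa> * x) - cos (v + M * x)"]) auto
  qed
  then show ?thesis by (simp add: f_def)
qed

text \<open>By the mean value theorem each increment is \<open>d\<close> times a derivative at a
  point within \<open>d\<close> of \<open>\<phi>\<close>, and sine and cosine are 1-Lipschitz. This
  measures the deviation of a short arc from its tangent.\<close>

lemma sin_cos_linear_approx:
  fixes \<phi> d :: real
  assumes "0 \<le> d"
  shows "\<bar>sin (\<phi> + d) - sin \<phi> - d * cos \<phi>\<bar> \<le> d * d"
    and "\<bar>cos \<phi> - cos (\<phi> + d) - d * sin \<phi>\<bar> \<le> d * d"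
proof -
  have "\<bar>sin (\<phi> + d) - sin \<phi> - d * cos \<phi>\<bar> \<le> d * d
      \<and> \<bar>cos \<phi> - cos (\<phi> + d) - d * sin \<phi>\<bar> \<le> d * d"
  proof (cases "d = 0")
    case False
    with assms have "\<phi> < \<phi> + d" by simp
    from MVT2[OF this, of sin cos] obtain u where u: "\<phi> < u" "u < \<phi> + d"
      "sin (\<phi> + d) - sin \<phi> = d * cos u" by auto
    have "((\<lambda>x. - cos x) has_real_derivative sin x) (at x)" for x :: real
      by (auto intro!: derivative_eq_intros)
    from MVT2[OF \<open>\<phi> < \<phi> + d\<close> this] obtain v where v: "\<phi> < v" "v < \<phi> + d"
      "cos \<phi> - cos (\<phi> + d) = d * sin v" by auto
    have "\<bar>cos u - cos \<phi>\<bar> \<le> d"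
    proof -
      from MVT2[OF u(1), of cos "\<lambda>x. - sin x"] obtain w where "cos u - cos \<phi> = (u - \<phi>) * - sin w"
        by auto
      then have "\<bar>cos u - cos \<phi>\<bar> = (u - \<phi>) * \<bar>sin w\<bar>" using u by (simp add: abs_mult)
      also have "\<dots> \<le> u - \<phi>" using u mult_left_le[of "\<bar>sin w\<bar>" "u - \<phi>"] by simp
      finally show ?thesis using u by linarith
    qed
    moreover have "\<bar>sin v - sin \<phi>\<bar> \<le> d"
    proof -
      from MVT2[OF v(1), of sin cos] obtain w where "sin v - sin \<phi> = (v - \<phi>) * cos w" by auto
      then have "\<bar>sin v - sin \<phi>\<bar> = (v - \<phi>) * \<bar>cos w\<bar>" using v by (simp add: abs_mult)
      also have "\<dots> \<le> v - \<phi>" using v mult_left_le[of "\<bar>cos w\<bar>" "v - \<phi>"] by simp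
      finally show ?thesis using v by linarith
    qed
    ultimately show ?thesis
      using u(3) v(3) assms
      by (auto simp: abs_mult intro!: mult_left_mono simp flip: right_diff_distrib)
  qed simp
  then show "\<bar>sin (\<phi> + d) - sin \<phi> - d * cos \<phi>\<bar> \<le> d * d"
    and "\<bar>cos \<phi> - cos (\<phi> + d) - d * sin \<phi>\<bar> \<le> d * d" by auto
qed

lemma norm_pair_le: "norm (x, y) \<le> \<bar>x\<bar> + \<bar>y\<bar>" for x y :: real
  using norm_Pair_le[of x y] by simp

definition proj :: "real \<Rightarrow> real \<times> real \<Rightarrow> real" where
  "proj \<eta> p = fst p * cos \<eta> + snd p * sin \<eta>"

section \<open>Curves made of circular arcs and bounds for their chords\<close>

locale curvature =
  fixes a m M :: real and k :: "(real \<times> real) \<times> real \<Rightarrow> real"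
  assumes a_pos: "0 < a" and m_pos: "0 < m" and M_a: "M * a < 1"
    and k_ge: "\<And>p t. t \<in> {0..1} \<Longrightarrow> m \<le> k (p, t)"
    and k_le: "\<And>p t. t \<in> {0..1} \<Longrightarrow> k (p, t) \<le> M"
    and k_cont: "continuous_on (UNIV \<times> {0..1}) k"
begin

lemma m_le_M: "m \<le> M"
  using k_ge[of 0 0] k_le[of 0 0] by simp

lemma M_pos: "0 < M"
  using m_pos m_le_M by simp

text \<open>An Euler scheme with \<open>n\<close> steps whose pieces are circular arcs: a state consists of the
  position and the tangent angle, \<open>\<theta>\<close> is the initial angle and \<open>c\<close> the speed. The curve stops as
  soon as it has turned by \<open>2 * pi\<close>.\<close>

primrec arcs :: "nat \<Rightarrow> real \<Rightarrow> real \<Rightarrow> nat \<Rightarrow> (real \<times> real) \<times> real" where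
  "arcs n \<theta> c 0 = ((a, 0), \<theta>)"
| "arcs n \<theta> c (Suc j) =
    (let p = fst (arcs n \<theta> c j); \<phi> = snd (arcs n \<theta> c j); \<kappa> = k (p, real j / real n);
         \<phi>' = min (\<phi> + c * \<kappa> / real n) (\<theta> + 2*pi)
     in (p + ((sin \<phi>' - sin \<phi>) / \<kappa>, (cos \<phi> - cos \<phi>') / \<kappa>), \<phi>'))"

definition pos :: "nat \<Rightarrow> real \<Rightarrow> real \<Rightarrow> nat \<Rightarrow> real \<times> real" where
  "pos n \<theta> c j = fst (arcs n \<theta> c j)"

definition ang :: "nat \<Rightarrow> real \<Rightarrow> real \<Rightarrow> nat \<Rightarrow> real" where
  "ang n \<theta> c j = snd (arcs n \<theta> c j)"

definition curv :: "nat \<Rightarrow> real \<Rightarrow> real \<Rightarrow> nat \<Rightarrow> real" where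
  "curv n \<theta> c j = k (pos n \<theta> c j, real j / real n)"

lemma pos_0: "pos n \<theta> c 0 = (a, 0)"
  and ang_0: "ang n \<theta> c 0 = \<theta>"
  by (simp_all add: pos_def ang_def)

lemma ang_Suc: "ang n \<theta> c (Suc j) = min (ang n \<theta> c j + c * curv n \<theta> c j / real n) (\<theta> + 2*pi)"
  by (simp add: ang_def pos_def curv_def Let_def)

lemma pos_Suc: "pos n \<theta> c (Suc j) = pos n \<theta> c j +
    ((sin (ang n \<theta> c (Suc j)) - sin (ang n \<theta> c j)) / curv n \<theta> c j,
     (cos (ang n \<theta> c j) - cos (ang n \<theta> c (Suc j))) / curv n \<theta> c j)"
  by (simp add: ang_def pos_def curv_def Let_def)

lemma curv_ge: "j \<le> n \<Longrightarrow> m \<le> curv n \<theta> c j"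
  and curv_le: "j \<le> n \<Longrightarrow> curv n \<theta> c j \<le> M"
  unfolding curv_def by (auto intro!: k_ge k_le simp: divide_le_eq)

lemma curv_pos: "j \<le> n \<Longrightarrow> 0 < curv n \<theta> c j"
  using curv_ge[of j n \<theta> c] m_pos by linarith

lemma ang_le: "ang n \<theta> c j \<le> \<theta> + 2*pi"
  by (cases j) (auto simp: ang_0 ang_Suc)

lemma ang_step:
  assumes "0 \<le> c" "j < n"
  shows "ang n \<theta> c j \<le> ang n \<theta> c (Suc j)"
    and "ang n \<theta> c (Suc j) \<le> ang n \<theta> c j + c * curv n \<theta> c j / real n"
    and "ang n \<theta> c (Suc j) \<le> ang n \<theta> c j + c * M / real n"
proof -
  have "0 \<le> c * curv n \<theta> c j / real n"
    using assms curv_pos[of j n \<theta> c] by simp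
  then show "ang n \<theta> c j \<le> ang n \<theta> c (Suc j)"
    using ang_le[of n \<theta> c j] by (simp add: ang_Suc)
  show *: "ang n \<theta> c (Suc j) \<le> ang n \<theta> c j + c * curv n \<theta> c j / real n"
    by (simp add: ang_Suc)
  have "c * curv n \<theta> c j / real n \<le> c * M / real n"
    using assms curv_le[of j n \<theta> c] by (intro divide_right_mono mult_left_mono) auto
  with * show "ang n \<theta> c (Suc j) \<le> ang n \<theta> c j + c * M / real n" by linarith
qed

lemma ang_mono:
  assumes "0 \<le> c" "i \<le> j" "j \<le> n"
  shows "ang n \<theta> c i \<le> ang n \<theta> c j"
  using assms(2,3)
proof (induction j rule: dec_induct)
  case (step l)
  then show ?case using ang_step(1)[OF assms(1), of l n \<theta>] by force
qed simp

lemma ang_diff_le: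
  assumes "0 \<le> c" "i \<le> j" "j \<le> n"
  shows "ang n \<theta> c j - ang n \<theta> c i \<le> c * M * (real j - real i) / real n"
  using assms(2,3)
proof (induction j rule: dec_induct)
  case (step l)
  have "c * M * (real (Suc l) - real i) / real n = c * M * (real l - real i) / real n + c * M / real n"
    by (simp add: algebra_simps add_divide_distrib diff_divide_distrib)
  with step ang_step(3)[OF assms(1), of l n \<theta>] show ?case by force
qed simp

text \<open>Angles are monotone, so a cut at \<open>\<theta> + 2*pi\<close> in any step would
  persist to step \<open>n\<close>.\<close>

lemma ang_Suc_not_stopped:
  assumes "0 \<le> c" "j < n" "ang n \<theta> c n < \<theta> + 2*pi"
  shows "ang n \<theta> c (Suc j) = ang n \<theta> c j + c * curv n \<theta> c j / real n"
  using ang_mono[OF assms(1), of "Suc j" n n \<theta>] assms(2,3) by (auto simp: ang_Suc min_def split: if_splits)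

text \<open>An uncut angle grows by at least \<open>c * m / n\<close> in each step, hence by at
  least a full turn in \<open>n\<close> steps.\<close>

lemma ang_stopped:
  assumes "2*pi \<le> c * m" "0 < n"
  shows "ang n \<theta> c n = \<theta> + 2*pi"
proof (rule ccontr)
  have "0 \<le> c"
    using assms m_pos by (smt (verit) mult_neg_pos pi_gt_zero)
  assume "ang n \<theta> c n \<noteq> \<theta> + 2*pi"
  with ang_le[of n \<theta> c n] have *: "ang n \<theta> c n < \<theta> + 2*pi" by linarith
  have "\<theta> + c * m * real j / real n \<le> ang n \<theta> c j" if "j \<le> n" for j
    using that
  proof (induction j)
    case (Suc j)
    have "c * m / real n \<le> c * curv n \<theta> c j / real n"
      using Suc.prems curv_ge[of j n \<theta> c] \<open>0 \<le> c\<close> by (intro divide_right_mono mult_left_mono) auto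
    with Suc ang_Suc_not_stopped[OF \<open>0 \<le> c\<close> _ *, of j] show ?case
      by (simp add: algebra_simps add_divide_distrib)
  qed (simp add: ang_0)
  from this[of n] * assms show False by simp
qed

lemma proj_step:
  "proj \<eta> (pos n \<theta> c (Suc j)) - proj \<eta> (pos n \<theta> c j)
    = (sin (ang n \<theta> c (Suc j) - \<eta>) - sin (ang n \<theta> c j - \<eta>)) / curv n \<theta> c j"
  by (simp add: proj_def pos_Suc sin_diff field_simps diff_divide_distrib add_divide_distrib)

text \<open>The scheme sees the angle only through sine, cosine and its difference to
  \<open>\<theta>\<close>. So the end position is periodic in \<open>\<theta>\<close>, while the
  angle itself gains a full turn.\<close>

lemma ang_shift: "ang n (\<theta> + 2*pi) c j = ang n \<theta> c j + 2*pi"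
  and pos_shift: "pos n (\<theta> + 2*pi) c j = pos n \<theta> c j"
proof (induction j)
  case (Suc j)
  have "curv n (\<theta> + 2*pi) c j = curv n \<theta> c j"
    by (simp add: curv_def Suc)
  moreover from this show "ang n (\<theta> + 2*pi) c (Suc j) = ang n \<theta> c (Suc j) + 2*pi"
    by (simp add: ang_Suc Suc)
  ultimately show "pos n (\<theta> + 2*pi) c (Suc j) = pos n \<theta> c (Suc j)"
    by (simp add: pos_Suc Suc)
qed (simp_all add: pos_0 ang_0)

text \<open>For merely continuous \<open>k\<close> the exact initial value problem need not have
  unique solutions, let alone continuous dependence. A state of the scheme is a finite composition
  of continuous maps; the divisions are safe because the curvature is positive.\<close>

lemma continuous_on_pos_ang:
  "j \<le> n \<Longrightarrow> continuous_on UNIV (\<lambda>x. pos n (fst x) (snd x) j) \<and>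
    continuous_on UNIV (\<lambda>x. ang n (fst x) (snd x) j)"
proof (induction j)
  case (Suc j)
  then have pos: "continuous_on UNIV (\<lambda>x. pos n (fst x) (snd x) j)"
    and ang: "continuous_on UNIV (\<lambda>x. ang n (fst x) (snd x) j)" by auto
  have curv: "continuous_on UNIV (\<lambda>x. curv n (fst x) (snd x) j)"
    unfolding curv_def using Suc.prems
    by (intro continuous_on_compose2[OF k_cont] continuous_intros pos) (auto simp: divide_le_eq)
  have nz: "curv n \<theta> c j \<noteq> 0" for \<theta> c
    using curv_pos[of j n \<theta> c] Suc.prems by simp
  have ang': "continuous_on UNIV (\<lambda>x. ang n (fst x) (snd x) (Suc j))"
    unfolding ang_Suc
    by (cases "n = 0") (use ang in \<open>auto intro!: continuous_on_min continuous_intros curv\<close>)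
  have "continuous_on UNIV (\<lambda>x. pos n (fst x) (snd x) (Suc j))"
    unfolding pos_Suc
    by (intro continuous_intros curv ang ang' pos) (auto simp: nz)
  with ang' show ?case by blast
qed (auto simp: pos_0 ang_0 intro!: continuous_intros)

lemmas continuous_on_pos = continuous_on_pos_ang[THEN conjunct1]
  and continuous_on_ang = continuous_on_pos_ang[THEN conjunct2]

text \<open>On an arc the integral of the cosine against \<open>1/\<kappa>\<close> is largest when \<open>1/\<kappa>\<close> is \<open>1/m\<close> where the
  cosine is positive and \<open>1/M\<close> where it is negative.\<close>

lemma proj_step_le:
  assumes "0 \<le> c" "j < n"
  shows "proj \<eta> (pos n \<theta> c (Suc j)) - proj \<eta> (pos n \<theta> c j)
    \<le> (cos_pos_integral (ang n \<theta> c (Suc j) - \<eta>) - cos_pos_integral (ang n \<theta> c j - \<eta>)) / m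
      - (cos_neg_integral (ang n \<theta> c (Suc j) - \<eta>) - cos_neg_integral (ang n \<theta> c j - \<eta>)) / M"
proof -
  let ?u = "ang n \<theta> c j - \<eta>" and ?v = "ang n \<theta> c (Suc j) - \<eta>" and ?\<kappa> = "curv n \<theta> c j"
  have "?u \<le> ?v" using ang_step(1)[OF assms] by simp
  have "(sin ?v - sin ?u) / ?\<kappa> = (cos_pos_integral ?v - cos_pos_integral ?u) / ?\<kappa>
      - (cos_neg_integral ?v - cos_neg_integral ?u) / ?\<kappa>"
    by (simp add: cos_neg_integral_def flip: diff_divide_distrib)
  also have "\<dots> \<le> (cos_pos_integral ?v - cos_pos_integral ?u) / m
      - (cos_neg_integral ?v - cos_neg_integral ?u) / M"
    using curv_ge[of j n \<theta> c] curv_le[of j n \<theta> c] curv_pos[of j n \<theta> c] assms m_pos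
      cos_pos_integral_mono[OF \<open>?u \<le> ?v\<close>] cos_neg_integral_mono[OF \<open>?u \<le> ?v\<close>]
    by (intro diff_mono divide_left_mono) (auto intro!: mult_pos_pos M_pos)
  finally show ?thesis by (simp add: proj_step)
qed

text \<open>Summing the one-step bounds leaves the increments of the two integrals over a full turn,
  which are both 2.\<close>

lemma proj_stopped_le:
  assumes "0 \<le> c" "ang n \<theta> c n = \<theta> + 2*pi"
  shows "proj \<eta> (pos n \<theta> c n) - proj \<eta> (a, 0) \<le> 2 / m - 2 / M"
proof -
  have "proj \<eta> (pos n \<theta> c j) - proj \<eta> (a, 0)
    \<le> (cos_pos_integral (ang n \<theta> c j - \<eta>) - cos_pos_integral (\<theta> - \<eta>)) / m
      - (cos_neg_integral (ang n \<theta> c j - \<eta>) - cos_neg_integral (\<theta> - \<eta>)) / M" if "j \<le> n" for j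
    using that
  proof (induction j)
    case (Suc j)
    with proj_step_le[OF assms(1), of j n \<eta> \<theta>] show ?case
      by (simp add: diff_divide_distrib)
  qed (simp add: ang_0 pos_0)
  from this[of n] assms(2) show ?thesis
    using cos_pos_integral_period[of "\<theta> - \<eta>"] cos_neg_integral_period[of "\<theta> - \<eta>"]
    by (simp add: algebra_simps)
qed

text \<open>Seen from the middle grid point, the tangent deviates after \<open>i\<close> steps, in
  either direction, by at most \<open>M * \<tau> * i\<close>. Comparing arc by arc with a circle of
  curvature \<open>M\<close>, each half of the curve contributes at least
  \<open>sin (c * M / 2) / M\<close>.\<close>

lemma proj_mid_ge:
  assumes c: "0 \<le> c" "c * M \<le> pi" and n: "n = 2 * N" "0 < N"
  shows "2 / M * sin (c * M / 2) \<le> proj (ang n \<theta> c N) (pos n \<theta> c n) - proj (ang n \<theta> c N) (a, 0)"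
proof -
  define \<eta> where "\<eta> = ang n \<theta> c N"
  define \<tau> where "\<tau> = c / real n"
  have \<tau>: "0 \<le> \<tau>" using c by (simp add: \<tau>_def)
  have M\<tau>: "M * \<tau> * real N = c * M / 2" using n by (simp add: \<tau>_def)
  have "ang n \<theta> c n - ang n \<theta> c 0 \<le> pi"
    using ang_diff_le[OF c(1), of 0 n n \<theta>] c n by simp
  then have small: "ang n \<theta> c n < \<theta> + 2*pi" using pi_gt_zero unfolding ang_0 by linarith
  have step: "ang n \<theta> c (Suc j) = ang n \<theta> c j + curv n \<theta> c j * \<tau>" if "j < n" for j
    using ang_Suc_not_stopped[OF c(1) that small] by (simp add: \<tau>_def mult.commute)
  \<comment> \<open>The comparison circle turns by at most pi/2 on each half, so
    \<open>arc_projection_ge\<close> applies to every arc.\<close>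
  have bound: "M * \<tau> * real i + M * \<tau> \<le> pi" if "i < N" for i
  proof -
    have "M * \<tau> * (real i + 1) \<le> M * \<tau> * real N"
      using that M_pos \<tau> by (intro mult_left_mono) auto
    then show ?thesis using M\<tau> c(2) pi_gt_zero unfolding distrib_left mult_1_right by linarith
  qed
  have diff: "ang n \<theta> c j - ang n \<theta> c i \<le> M * \<tau> * (real j - real i)" if "i \<le> j" "j \<le> n" for i j
    using ang_diff_le[OF c(1) that, of \<theta>] by (simp add: \<tau>_def mult_ac)
  have fwd: "sin (M * \<tau> * real i) / M \<le> proj \<eta> (pos n \<theta> c (N + i)) - proj \<eta> (pos n \<theta> c N)"
    if "i \<le> N" for i
    using that
  proof (induction i)
    case (Suc i)
    have "(sin (M * \<tau> * real i + M * \<tau>) - sin (M * \<tau> * real i)) / M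
      \<le> (sin ((ang n \<theta> c (N + i) - \<eta>) + curv n \<theta> c (N + i) * \<tau>) - sin (ang n \<theta> c (N + i) - \<eta>))
        / curv n \<theta> c (N + i)"
      using Suc.prems diff[of N "N + i"] ang_mono[OF c(1), of N "N + i" n \<theta>] n \<tau> bound[of i]
        curv_pos[of "N + i" n \<theta> c] curv_le[of "N + i" n \<theta> c]
      by (intro arc_projection_ge) (auto simp: \<eta>_def)
    also have "\<dots> = proj \<eta> (pos n \<theta> c (N + Suc i)) - proj \<eta> (pos n \<theta> c (N + i))"
      using proj_step[of \<eta> n \<theta> c "N + i"] step[of "N + i"] Suc.prems n by (simp add: algebra_simps)
    finally show ?case using Suc by (simp add: algebra_simps diff_divide_distrib)
  qed simp
  \<comment> \<open>Run backwards from the middle, the angle \<open>\<eta> - ang\<close> increases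
    from 0, so the same comparison works.\<close>
  have bwd: "sin (M * \<tau> * real i) / M \<le> proj \<eta> (pos n \<theta> c N) - proj \<eta> (pos n \<theta> c (N - i))"
    if "i \<le> N" for i
    using that
  proof (induction i)
    case (Suc i)
    define j where "j = N - Suc i"
    have j: "N - i = Suc j" "j < n" "real N - real (Suc j) = real i" "Suc j \<le> N"
      using Suc.prems n by (auto simp: j_def)
    have "(sin (M * \<tau> * real i + M * \<tau>) - sin (M * \<tau> * real i)) / M
      \<le> (sin ((\<eta> - ang n \<theta> c (Suc j)) + curv n \<theta> c j * \<tau>) - sin (\<eta> - ang n \<theta> c (Suc j)))
        / curv n \<theta> c j"
      using Suc.prems diff[of "Suc j" N] ang_mono[OF c(1), of "Suc j" N n \<theta>] n \<tau> bound[of i] j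
        curv_pos[of j n \<theta> c] curv_le[of j n \<theta> c]
      by (intro arc_projection_ge) (auto simp: \<eta>_def)
    also have "\<dots> = (sin (\<eta> - ang n \<theta> c j) - sin (\<eta> - ang n \<theta> c (Suc j))) / curv n \<theta> c j"
      using step[OF j(2)] by simp
    also have "\<dots> = (sin (ang n \<theta> c (Suc j) - \<eta>) - sin (ang n \<theta> c j - \<eta>)) / curv n \<theta> c j"
      using sin_minus[of "ang n \<theta> c (Suc j) - \<eta>"] sin_minus[of "ang n \<theta> c j - \<eta>"] by simp
    also have "\<dots> = proj \<eta> (pos n \<theta> c (N - i)) - proj \<eta> (pos n \<theta> c (N - Suc i))"
      unfolding j(1) j_def[symmetric] proj_step ..
    finally show ?case using Suc by (simp add: algebra_simps diff_divide_distrib)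
  qed simp
  show ?thesis
    using fwd[of N] bwd[of N] n by (simp add: M\<tau> \<eta>_def pos_0 flip: mult_2)
qed

text \<open>The winding lemma with \<open>R = 2 * a\<close>, applied to the chord from
  \<open>(a, 0)\<close>: the chord \<open>- 2 * a\<close> leads to \<open>(- a, 0)\<close>. The
  speed \<open>c0\<close> may lie on either side of \<open>c1\<close>.\<close>

lemma discrete_shooting:
  assumes c0: "0 \<le> c0" and c1: "0 \<le> c1" "c1 * M \<le> pi" "a < sin (c1 * M / 2) / M"
    and end0: "\<And>\<theta>. - a < fst (pos n \<theta> c0 n)" and n: "n = 2 * N" "0 < N"
  shows "\<exists>\<theta>\<in>{0..2*pi}. \<exists>c\<in>closed_segment c0 c1. pos n \<theta> c n = (- a, 0)"
proof -
  define C where "C s = (1 - s) * c0 + s * c1" for s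
  define P where "P x = (let p = pos n (fst x) (C (snd x)) n in Complex (fst p - a) (snd p))" for x
  \<comment> \<open>The tangent angle at the middle follows the initial angle once around and, by
    \<open>proj_mid_ge\<close>, the chord for \<open>c1\<close> has a component above
    \<open>2 * a\<close> in its direction.\<close>
  define \<mu> where "\<mu> \<theta> = ang n \<theta> c1 N" for \<theta>
  have "continuous_on UNIV (\<lambda>x. pos n (fst (fst x, C (snd x))) (snd (fst x, C (snd x))) n)"
    unfolding C_def
    by (rule continuous_on_compose2[OF continuous_on_pos[of n n]]) (auto intro!: continuous_intros)
  then have "continuous_on UNIV P"
    unfolding P_def Let_def Complex_eq by (auto intro!: continuous_intros)
  then have "\<exists>z\<in>{0..2*pi} \<times> {0..1}. P z = - of_real (2 * a)"
  proof (rule homotopy_from_disc_to_turning_loop_hits[OF continuous_on_subset, where \<mu> = \<mu>])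
    show "P (2*pi, s) = P (0, s)" for s
      using pos_shift[of n 0 "C s" n] by (simp add: P_def)
    show "- (2 * a) < Re (P (\<theta>, 0))" for \<theta>
      using end0[of \<theta>] by (simp add: P_def C_def Let_def)
    show "2 * a < Re (P (\<theta>, 1) * cis (- \<mu> \<theta>))" for \<theta>
    proof -
      have "2 * a < 2 / M * sin (c1 * M / 2)" using c1 by simp
      also have "\<dots> \<le> proj (\<mu> \<theta>) (pos n \<theta> c1 n) - proj (\<mu> \<theta>) (a, 0)"
        unfolding \<mu>_def by (rule proj_mid_ge[OF c1(1,2) n])
      also have "\<dots> = Re (P (\<theta>, 1) * cis (- \<mu> \<theta>))"
        by (simp add: P_def C_def Let_def proj_def algebra_simps)
      finally show ?thesis .
    qed
    have "continuous_on {0..2*pi} (\<lambda>\<theta>. ang n (fst (\<theta>, c1)) (snd (\<theta>, c1)) N)"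
      by (rule continuous_on_compose2[OF continuous_on_ang[of N n]])
        (use n in \<open>auto intro!: continuous_intros\<close>)
    then show "continuous_on {0..2*pi} \<mu>" by (simp add: \<mu>_def)
    show "\<mu> (2*pi) = \<mu> 0 + 2*pi"
      using ang_shift[of n 0 c1 N] by (simp add: \<mu>_def)
  qed (use a_pos in auto)
  then obtain \<theta> s where "\<theta> \<in> {0..2*pi}" "s \<in> {0..1}" "P (\<theta>, s) = - of_real (2 * a)"
    by auto
  then show ?thesis
    by (intro bexI[of _ \<theta>] bexI[of _ "C s"])
      (auto simp: P_def C_def Let_def complex_eq_iff prod_eq_iff closed_segment_def)
qed

section \<open>Passage to the limit\<close>

text \<open>The equation as a first-order field for position and tangent angle. The speed is an
  argument so that joint continuity also covers a convergent sequence of speeds.\<close>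

definition velocity :: "((real \<times> real) \<times> real) \<times> real \<times> real \<Rightarrow> (real \<times> real) \<times> real" where
  "velocity = (\<lambda>((p, \<phi>), t, c). ((c * cos \<phi>, c * sin \<phi>), c * k (p, t)))"

lemma velocity_continuous: "continuous_on (UNIV \<times> {0..1} \<times> UNIV) velocity"
  unfolding velocity_def case_prod_beta
  by (intro continuous_intros continuous_on_compose2[OF k_cont]) auto

lemma arcs_eq: "arcs n \<theta> c j = (pos n \<theta> c j, ang n \<theta> c j)"
  by (simp add: pos_def ang_def)

text \<open>With \<open>d\<close> the turning of the step, the angle component is exact and each
  position component is off by at most \<open>d * d / \<kappa> = (c / n) * d\<close>, which is of
  order \<open>1 / n^2\<close>.\<close>

lemma arcs_step_velocity:
  assumes "0 \<le> c" "j < n" "ang n \<theta> c n < \<theta> + 2*pi"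
  shows "norm (arcs n \<theta> c (Suc j) - arcs n \<theta> c j
      - (1 / real n) *\<^sub>R velocity (arcs n \<theta> c j, real j / real n, c)) \<le> 2 * c\<^sup>2 * M / real n / real n"
proof -
  define \<kappa> \<phi> d where "\<kappa> = curv n \<theta> c j" and "\<phi> = ang n \<theta> c j" and "d = c * curv n \<theta> c j / real n"
  have \<kappa>: "0 < \<kappa>" "\<kappa> \<le> M"
    unfolding \<kappa>_def using curv_pos[of j n \<theta> c] curv_le[of j n \<theta> c] assms by auto
  have d: "0 \<le> d" "d / \<kappa> = c / real n"
    using assms \<kappa> by (auto simp: d_def \<kappa>_def)
  have ang: "ang n \<theta> c (Suc j) = \<phi> + d"
    unfolding \<phi>_def d_def by (rule ang_Suc_not_stopped[OF assms])
  have "arcs n \<theta> c (Suc j) - arcs n \<theta> c j - (1 / real n) *\<^sub>R velocity (arcs n \<theta> c j, real j / real n, c)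
    = (((sin (\<phi> + d) - sin \<phi> - d * cos \<phi>) / \<kappa>, (cos \<phi> - cos (\<phi> + d) - d * sin \<phi>) / \<kappa>), 0)"
    (is "_ = ((?x, ?y), 0)")
  proof -
    have "c * x / real n = d * x / \<kappa>" for x using d(2) by (metis times_divide_eq_left)
    moreover have "c * k (pos n \<theta> c j, real j / real n) / real n = d"
      by (simp add: d_def curv_def)
    ultimately show ?thesis
      by (simp add: arcs_eq velocity_def pos_Suc ang diff_divide_distrib flip: \<kappa>_def \<phi>_def)
  qed
  also have "norm \<dots> \<le> \<bar>?x\<bar> + \<bar>?y\<bar>"
    using norm_Pair_le[of "(?x, ?y)" "0::real"] norm_pair_le[of ?x ?y] by simp
  also have "\<dots> \<le> d * d / \<kappa> + d * d / \<kappa>"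
    using sin_cos_linear_approx[OF d(1), of \<phi>] \<kappa> by (intro add_mono) (auto intro!: divide_right_mono)
  also have "\<dots> = 2 * (c / real n) * d"
    using d(2) by (simp flip: times_divide_eq_left)
  also have "\<dots> \<le> 2 * (c / real n) * (c * M / real n)"
    unfolding d_def using \<kappa> assms by (intro mult_left_mono divide_right_mono) (auto simp: \<kappa>_def)
  also have "\<dots> = 2 * c\<^sup>2 * M / real n / real n" by (simp add: power2_eq_square)
  finally show ?thesis .
qed

lemma norm_velocity_le:
  assumes "0 \<le> c" "t \<in> {0..1}"
  shows "norm (velocity ((p, \<phi>), t, c)) \<le> c * (2 + M)"
proof -
  have "norm (velocity ((p, \<phi>), t, c)) \<le> \<bar>c * cos \<phi>\<bar> + \<bar>c * sin \<phi>\<bar> + \<bar>c * k (p, t)\<bar>"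
    using norm_Pair_le[of "(c * cos \<phi>, c * sin \<phi>)" "c * k (p, t)"] norm_pair_le[of "c * cos \<phi>" "c * sin \<phi>"]
    by (simp add: velocity_def)
  also have "\<dots> \<le> c * 1 + c * 1 + c * M"
    using assms k_ge[of t p] k_le[of t p] m_pos
    by (intro add_mono) (auto simp: abs_mult intro!: mult_left_mono mult_left_le)
  finally show ?thesis by (simp add: algebra_simps)
qed

text \<open>Interpolants of the arc states are uniformly bounded and equi-Lipschitz, so along a
  subsequence the speeds and the interpolants converge. No curve was cut, so every step follows
  \<open>velocity\<close> up to a quadratic error, and the limit satisfies the equation.\<close>

lemma limit_solution:
  fixes n :: "nat \<Rightarrow> nat" and \<theta> c :: "nat \<Rightarrow> real"
  assumes n: "filterlim n at_top sequentially" "\<And>i. 0 < n i"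
    and \<theta>: "\<And>i. \<theta> i \<in> {0..2*pi}" and c: "\<And>i. c i \<in> {q..r}" and q: "0 \<le> q"
    and not_stopped: "\<And>i. ang (n i) (\<theta> i) (c i) (n i) < \<theta> i + 2*pi"
    and end_pos: "\<And>i. pos (n i) (\<theta> i) (c i) (n i) = (- a, 0)"
  obtains C \<gamma> \<psi> where "C \<in> {q..r}"
    "\<And>t. t \<in> {0..1} \<Longrightarrow>
      ((\<lambda>t. (\<gamma> t, \<psi> t)) has_vector_derivative velocity ((\<gamma> t, \<psi> t), t, C)) (at t within {0..1})"
    "\<gamma> 0 = (a, 0)" "\<gamma> 1 = (- a, 0)" "\<psi> 1 - \<psi> 0 \<le> 2*pi"
proof -
  have c0: "0 \<le> c i" for i using c[of i] q by auto
  have r0: "0 \<le> r" using c0[of 0] c[of 0] by auto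
  obtain C u where "C \<in> {q..r}" and u: "strict_mono u" and cu: "(c \<circ> u) \<longlonglongrightarrow> C"
    using seq_compactE[of "{q..r}" c] c compact_imp_seq_compact[OF compact_Icc[of q r]] by blast
  \<comment> \<open>\<open>B\<close> bounds the one-step error times \<open>n^2\<close> for all
    speeds up to \<open>r\<close>; \<open>L\<close> adds the bound for the velocity and serves as
    common Lipschitz constant.\<close>
  define B where "B = 2 * r\<^sup>2 * M"
  define L where "L = B + r * (2 + M)"
  have B: "0 \<le> B" and L: "0 \<le> L" unfolding L_def B_def using M_pos r0 by auto
  have err: "norm (arcs (n i) (\<theta> i) (c i) (Suc j) - arcs (n i) (\<theta> i) (c i) j
      - (1 / real (n i)) *\<^sub>R velocity (arcs (n i) (\<theta> i) (c i) j, real j / real (n i), c i)) \<le> B / real (n i) / real (n i)"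
    if "j < n i" for i j
  proof -
    have "2 * (c i)\<^sup>2 * M \<le> B"
      unfolding B_def using c[of i] c0[of i] M_pos by (intro mult_right_mono mult_left_mono power_mono) auto
    then have "2 * (c i)\<^sup>2 * M / real (n i) / real (n i) \<le> B / real (n i) / real (n i)"
      by (intro divide_right_mono) auto
    with arcs_step_velocity[OF c0 that not_stopped] show ?thesis by (rule order_trans)
  qed
  have step: "norm (arcs (n i) (\<theta> i) (c i) (Suc j) - arcs (n i) (\<theta> i) (c i) j) \<le> L / real (n i)"
    if "j < n i" for i j
  proof -
    have "norm (velocity (arcs (n i) (\<theta> i) (c i) j, real j / real (n i), c i)) \<le> c i * (2 + M)"
      unfolding arcs_eq using that by (intro norm_velocity_le c0) (auto simp: divide_le_eq)
    also have "\<dots> \<le> r * (2 + M)" using c[of i] M_pos by (intro mult_right_mono) auto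
    finally have "norm ((1 / real (n i)) *\<^sub>R velocity (arcs (n i) (\<theta> i) (c i) j, real j / real (n i), c i))
        \<le> r * (2 + M) / real (n i)"
      by (simp add: divide_right_mono)
    moreover have "B / real (n i) / real (n i) \<le> B / real (n i)"
      using B n(2)[of i] using mult_left_mono[of 1 "real (n i)" "B / real (n i)"] by (simp add: field_simps)
    ultimately show ?thesis
      using err[OF that] norm_triangle_sub[of "arcs (n i) (\<theta> i) (c i) (Suc j) - arcs (n i) (\<theta> i) (c i) j"
        "(1 / real (n i)) *\<^sub>R velocity (arcs (n i) (\<theta> i) (c i) j, real j / real (n i), c i)"]
      by (simp add: L_def add_divide_distrib)
  qed
  have "\<exists>f. L-lipschitz_on {0..1} f \<and> (\<forall>j\<le>n i. f (real j / real (n i)) = arcs (n i) (\<theta> i) (c i) j)" for i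
    by (rule piecewise_linear_interpolation[where x = "arcs (n i) (\<theta> i) (c i)", OF n(2) L step])
  then obtain f where lip: "\<And>i. L-lipschitz_on {0..1} (f i)"
    and f: "\<And>i j. j \<le> n i \<Longrightarrow> f i (real j / real (n i)) = arcs (n i) (\<theta> i) (c i) j" by metis
  have f0: "f i 0 = ((a, 0), \<theta> i)" for i
    using f[of 0 i] by simp
  have f1: "f i 1 = ((- a, 0), ang (n i) (\<theta> i) (c i) (n i))" for i
    using f[of "n i" i] n(2)[of i] end_pos[of i] by (simp add: arcs_eq)
  have bound: "norm (f i t) \<le> a + 2*pi + L" if "t \<in> {0..1}" for i t
  proof -
    have "norm (f i t - f i 0) \<le> L"
      using lipschitz_onD[OF lip[of i] that, of 0] that L mult_left_mono[of t 1 L] by (simp add: dist_norm)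
    moreover have "norm (f i 0) \<le> a + 2*pi"
      using norm_Pair_le[of "(a, 0::real)" "\<theta> i"] norm_pair_le[of a 0] a_pos \<theta>[of i] by (simp add: f0)
    ultimately show ?thesis
      using norm_triangle_sub[of "f i t" "f i 0"] by linarith
  qed
  have equi: "\<exists>d. 0 < d \<and> (\<forall>i s. s \<in> {0..1} \<and> norm (t - s) < d \<longrightarrow> norm (f (u i) t - f (u i) s) < e)"
    if "t \<in> {0..1}" "0 < e" for t e
  proof (intro exI conjI allI impI)
    show "0 < e / (L + 1)" using that L by simp
    fix i s assume s: "s \<in> {0..1} \<and> norm (t - s) < e / (L + 1)"
    have "norm (f (u i) t - f (u i) s) \<le> L * \<bar>t - s\<bar>"
      using lipschitz_onD[OF lip[of "u i"] that(1), of s] s by (simp add: dist_norm)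
    also have "\<dots> \<le> (L + 1) * \<bar>t - s\<bar>" by (intro mult_right_mono) auto
    also have "\<dots> < e" using s L by (simp add: field_simps)
    finally show "norm (f (u i) t - f (u i) s) < e" .
  qed
  obtain g v where g: "continuous_on {0..1} g" and v: "strict_mono (v :: nat \<Rightarrow> nat)"
    and unif: "\<And>e. 0 < e \<Longrightarrow> \<exists>N. \<forall>i x. i \<ge> N \<and> x \<in> {0..1} \<longrightarrow> norm (f (u (v i)) x - g x) < e"
    using Arzela_Ascoli[where \<F> = "\<lambda>i. f (u i)", OF compact_Icc bound equi] by blast
  \<comment> \<open>Indices thinned out twice: by \<open>u\<close> for the speeds, then by
    \<open>v\<close> for the interpolants.\<close>
  define w where "w i = u (v i)" for i
  have w: "filterlim w sequentially sequentially"
    unfolding w_def using u v by (intro filterlim_subseq) (simp add: strict_mono_def)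
  have cw: "(\<lambda>i. c (w i)) \<longlonglongrightarrow> C"
    using LIMSEQ_subseq_LIMSEQ[OF cu v] by (simp add: o_def w_def)
  have nw: "filterlim (\<lambda>i. n (w i)) at_top sequentially"
    using n(1) w by (rule filterlim_compose)
  have lim: "(\<lambda>i. f (w i) s) \<longlonglongrightarrow> g s" if "s \<in> {0..1}" for s
    unfolding LIMSEQ_iff w_def using unif that by blast
  have deriv: "(g has_vector_derivative velocity (g t, t, C)) (at t within {0..1})" if t: "t \<in> {0..1}" for t
  proof (rule has_vector_derivative_limit_of_grid_functions[where f = "\<lambda>i. f (w i)" and n = "\<lambda>i. n (w i)" and L = L, OF nw lip lim t])
    fix e :: real assume e: "0 < e"
    \<comment> \<open>Half of \<open>e\<close> is spent on replacing the velocity at a nearby grid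
      state by the one at the limit, the other half on the one-step error
      \<open>B / n\<close>.\<close>
    obtain d where d: "0 < d" and vel: "\<And>x. \<lbrakk>x \<in> UNIV \<times> {0..1} \<times> UNIV; dist x (g t, t, C) < d\<rbrakk>
        \<Longrightarrow> dist (velocity x) (velocity (g t, t, C)) < e / 2"
      using velocity_continuous[unfolded continuous_on_iff, rule_format, of "(g t, t, C)" "e / 2"] t e by auto
    obtain d' where d': "0 < d'" and gd: "\<And>s. \<lbrakk>s \<in> {0..1}; dist s t < d'\<rbrakk> \<Longrightarrow> dist (g s) (g t) < d / 4"
      using g[unfolded continuous_on_iff, rule_format, of t "d / 4"] t d by auto
    obtain N where N: "\<And>i x. \<lbrakk>i \<ge> N; x \<in> {0..1}\<rbrakk> \<Longrightarrow> norm (f (w i) x - g x) < d / 4"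
      using unif[of "d / 4"] d unfolding w_def by auto
    have "\<forall>\<^sub>F i in sequentially. dist (c (w i)) C < d / 4"
      using cw d by (intro tendstoD) auto
    moreover have "\<forall>\<^sub>F i in sequentially. B / real (n (w i)) < e / 2"
    proof (rule order_tendstoD)
      have "filterlim (\<lambda>i. real (n (w i))) at_infinity sequentially"
        by (intro filterlim_at_top_imp_at_infinity filterlim_compose[OF filterlim_real_sequentially nw])
      then show "(\<lambda>i. B / real (n (w i))) \<longlonglongrightarrow> 0"
        by (rule tendsto_divide_0[OF tendsto_const])
    qed (use e in auto)
    moreover note eventually_ge_at_top[of N]
    ultimately have "\<forall>\<^sub>F i in sequentially. \<forall>j<n (w i). \<bar>real j / real (n (w i)) - t\<bar> < min (d / 4) d' \<longrightarrow>
      norm (f (w i) (real (Suc j) / real (n (w i))) - f (w i) (real j / real (n (w i)))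
          - (1 / real (n (w i))) *\<^sub>R velocity (g t, t, C)) \<le> e / real (n (w i))"
    proof eventually_elim
      case (elim i)
      show ?case
      proof (intro allI impI)
        fix j assume j: "j < n (w i)" and near: "\<bar>real j / real (n (w i)) - t\<bar> < min (d / 4) d'"
        define s where "s = real j / real (n (w i))"
        define A where "A = arcs (n (w i)) (\<theta> (w i)) (c (w i))"
        have s: "s \<in> {0..1}" "\<bar>s - t\<bar> < d / 4" "\<bar>s - t\<bar> < d'"
          using j near by (auto simp: s_def)
        have A: "f (w i) s = A j" "f (w i) (real (Suc j) / real (n (w i))) = A (Suc j)"
          using j f[of j "w i"] f[of "Suc j" "w i"] by (auto simp: s_def A_def)
        have "dist (f (w i) s) (g t) < d / 2"
          using N[OF elim(3) s(1)] gd[of s] s dist_triangle[of "f (w i) s" "g t" "g s"] by (auto simp: dist_norm)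
        moreover have "dist (f (w i) s, s, c (w i)) (g t, t, C)
            \<le> dist (f (w i) s) (g t) + (dist s t + dist (c (w i)) C)"
          unfolding dist_Pair_Pair
          by (intro order_trans[OF sqrt_sum_squares_le_sum] add_mono order_refl) auto
        ultimately have "dist (f (w i) s, s, c (w i)) (g t, t, C) < d"
          using s(2) elim(1) by (simp add: dist_real_def)
        then have "norm (velocity (A j, s, c (w i)) - velocity (g t, t, C)) < e / 2"
          using vel[of "(f (w i) s, s, c (w i))"] s(1) by (simp add: A dist_norm)
        then have "norm ((1 / real (n (w i))) *\<^sub>R (velocity (A j, s, c (w i)) - velocity (g t, t, C)))
            \<le> (e / 2) / real (n (w i))"
          using divide_right_mono[of _ "e / 2" "real (n (w i))"] by simp
        moreover have "norm (A (Suc j) - A j - (1 / real (n (w i))) *\<^sub>R velocity (A j, s, c (w i)))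
            \<le> (e / 2) / real (n (w i))"
          using err[OF j] elim(2) order_trans[OF _ divide_right_mono[of "B / real (n (w i))" "e / 2" "real (n (w i))"]]
          by (auto simp: A_def s_def)
        ultimately have "norm ((A (Suc j) - A j - (1 / real (n (w i))) *\<^sub>R velocity (A j, s, c (w i)))
            + (1 / real (n (w i))) *\<^sub>R (velocity (A j, s, c (w i)) - velocity (g t, t, C)))
            \<le> (e / 2) / real (n (w i)) + (e / 2) / real (n (w i))"
          by (intro norm_triangle_mono)
        moreover have "(A (Suc j) - A j - (1 / real (n (w i))) *\<^sub>R velocity (A j, s, c (w i)))
            + (1 / real (n (w i))) *\<^sub>R (velocity (A j, s, c (w i)) - velocity (g t, t, C))
            = A (Suc j) - A j - (1 / real (n (w i))) *\<^sub>R velocity (g t, t, C)"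
          by (simp only: scaleR_diff_right) simp
        ultimately have "norm (A (Suc j) - A j - (1 / real (n (w i))) *\<^sub>R velocity (g t, t, C))
            \<le> (e / 2) / real (n (w i)) + (e / 2) / real (n (w i))"
          by (simp only:)
        then show "norm (f (w i) (real (Suc j) / real (n (w i))) - f (w i) (real j / real (n (w i)))
          - (1 / real (n (w i))) *\<^sub>R velocity (g t, t, C)) \<le> e / real (n (w i))"
          using A(1) unfolding A(2) s_def by simp
      qed
    qed
    then show "\<exists>d>0. \<forall>\<^sub>F i in sequentially. \<forall>j<n (w i). \<bar>real j / real (n (w i)) - t\<bar> < d \<longrightarrow>
      norm (f (w i) (real (Suc j) / real (n (w i))) - f (w i) (real j / real (n (w i)))
          - (1 / real (n (w i))) *\<^sub>R velocity (g t, t, C)) \<le> e / real (n (w i))"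
      using d d' by (intro exI[of _ "min (d / 4) d'"]) auto
  qed
  show thesis
  proof (rule that[of C "\<lambda>t. fst (g t)" "\<lambda>t. snd (g t)"])
    have lim01: "(\<lambda>i. fst (f (w i) s)) \<longlonglongrightarrow> fst (g s)" "(\<lambda>i. snd (f (w i) s)) \<longlonglongrightarrow> snd (g s)"
      if "s \<in> {0..1}" for s
      using lim[OF that] by (auto intro: tendsto_fst tendsto_snd)
    show "fst (g 0) = (a, 0)"
      using lim01(1)[of 0] by (simp add: f0 LIMSEQ_const_iff)
    show "fst (g 1) = (- a, 0)"
      using lim01(1)[of 1] by (simp add: f1 LIMSEQ_const_iff)
    have "(\<lambda>i. snd (f (w i) 1) - snd (f (w i) 0)) \<longlonglongrightarrow> snd (g 1) - snd (g 0)"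
      by (intro tendsto_diff lim01) auto
    \<comment> \<open>The strict bound on the turning of the approximations becomes a weak one in
      the limit.\<close>
    moreover have "snd (f (w i) 1) - snd (f (w i) 0) \<le> 2*pi" for i
      using not_stopped[of "w i"] by (simp add: f0 f1)
    ultimately show "snd (g 1) - snd (g 0) \<le> 2*pi"
      by (intro LIMSEQ_le_const2) auto
  qed (use \<open>C \<in> {q..r}\<close> deriv in simp_all)
qed

end

section \<open>Simplicity of solutions\<close>

lemma nondecreasing_on_unit_interval:
  fixes h :: "real \<Rightarrow> real"
  assumes "\<And>x. x \<in> {0..1} \<Longrightarrow> (h has_vector_derivative h' x) (at x within {0..1})"
    and "0 \<le> s" "s \<le> t" "t \<le> 1" and "\<And>x. \<lbrakk>s < x; x < t\<rbrakk> \<Longrightarrow> 0 \<le> h' x"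
  shows "h s \<le> h t"
proof (rule DERIV_nonneg_imp_increasing_open[OF \<open>s \<le> t\<close>])
  fix x assume x: "s < x" "x < t"
  then have "(h has_vector_derivative h' x) (at x)"
    using assms(1)[of x] assms(2-4) at_within_Icc_at[of 0 x 1] by simp
  then show "\<exists>y. (h has_real_derivative y) (at x) \<and> 0 \<le> y"
    using assms(5)[OF x] by (auto simp: has_real_derivative_iff_has_vector_derivative)
next
  have "continuous_on {0..1} h"
    using assms(1) by (meson continuous_on_eq_continuous_within has_vector_derivative_continuous)
  then show "continuous_on {s..t} h"
    by (rule continuous_on_subset) (use assms in auto)
qed

lemma increasing_on_unit_interval:
  fixes h :: "real \<Rightarrow> real"
  assumes "\<And>x. x \<in> {0..1} \<Longrightarrow> (h has_vector_derivative h' x) (at x within {0..1})"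
    and "0 \<le> s" "s < t" "t \<le> 1" and "\<And>x. \<lbrakk>s < x; x < t\<rbrakk> \<Longrightarrow> 0 < h' x"
  shows "h s < h t"
proof (rule DERIV_pos_imp_increasing_open[OF \<open>s < t\<close>])
  fix x assume x: "s < x" "x < t"
  then have "(h has_vector_derivative h' x) (at x)"
    using assms(1)[of x] assms(2-4) at_within_Icc_at[of 0 x 1] by simp
  then show "\<exists>y. (h has_real_derivative y) (at x) \<and> 0 < y"
    using assms(5)[OF x] by (auto simp: has_real_derivative_iff_has_vector_derivative)
next
  have "continuous_on {0..1} h"
    using assms(1) by (meson continuous_on_eq_continuous_within has_vector_derivative_continuous)
  then show "continuous_on {s..t} h"
    by (rule continuous_on_subset) (use assms in auto)
qed

section \<open>Solutions in terms of speed and tangent angle\<close>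

lemma has_vector_derivative_compose_real:
  fixes f g :: "real \<Rightarrow> real"
  assumes "(g has_vector_derivative g') (at x within S)" "(f has_real_derivative f') (at (g x))"
  shows "((\<lambda>x. f (g x)) has_vector_derivative f' * g') (at x within S)"
  using DERIV_chain2[of f f' g x g' S] assms by (simp add: has_real_derivative_iff_has_vector_derivative)

locale curvature_solution = curvature +
  fixes c :: real and \<gamma> :: "real \<Rightarrow> real \<times> real" and \<psi> :: "real \<Rightarrow> real"
  assumes c_nonneg: "0 \<le> c"
    and flow: "\<And>t. t \<in> {0..1} \<Longrightarrow>
      ((\<lambda>t. (\<gamma> t, \<psi> t)) has_vector_derivative velocity ((\<gamma> t, \<psi> t), t, c)) (at t within {0..1})"
    and start: "\<gamma> 0 = (a, 0)" and finish: "\<gamma> 1 = (- a, 0)"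
begin

lemma \<gamma>_deriv: "t \<in> {0..1} \<Longrightarrow>
    (\<gamma> has_vector_derivative (c * cos (\<psi> t), c * sin (\<psi> t))) (at t within {0..1})"
  and \<psi>_deriv: "t \<in> {0..1} \<Longrightarrow>
    (\<psi> has_vector_derivative c * k (\<gamma> t, t)) (at t within {0..1})"
  using bounded_linear.has_vector_derivative[OF bounded_linear_fst flow[of t]]
    bounded_linear.has_vector_derivative[OF bounded_linear_snd flow[of t]]
  by (simp_all add: velocity_def)

lemma proj_deriv: "t \<in> {0..1} \<Longrightarrow>
    ((\<lambda>t. proj \<eta> (\<gamma> t)) has_vector_derivative c * cos (\<psi> t - \<eta>)) (at t within {0..1})"
  using has_vector_derivative_add[OF
      has_vector_derivative_mult_left[OF bounded_linear.has_vector_derivative[OF bounded_linear_fst \<gamma>_deriv[of t]], of "cos \<eta>"]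
      has_vector_derivative_mult_left[OF bounded_linear.has_vector_derivative[OF bounded_linear_snd \<gamma>_deriv[of t]], of "sin \<eta>"]]
  by (simp add: proj_def cos_diff algebra_simps)

lemma comp_\<psi>_deriv: "t \<in> {0..1} \<Longrightarrow> (f has_real_derivative f') (at (\<psi> t)) \<Longrightarrow>
    ((\<lambda>t. f (\<psi> t)) has_vector_derivative f' * (c * k (\<gamma> t, t))) (at t within {0..1})"
  by (rule has_vector_derivative_compose_real[OF \<psi>_deriv])

lemma \<gamma>_cont: "continuous_on {0..1} \<gamma>"
  and \<psi>_cont: "continuous_on {0..1} \<psi>"
  using \<gamma>_deriv \<psi>_deriv by (meson continuous_on_eq_continuous_within has_vector_derivative_continuous)+

text \<open>At speed 0 the first coordinate could not get from \<open>a\<close> to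
  \<open>- a\<close>.\<close>

lemma c_pos: "0 < c"
proof -
  have "- proj pi (\<gamma> 0) \<le> - proj pi (\<gamma> 1)" if "c = 0"
    by (rule nondecreasing_on_unit_interval[of "\<lambda>t. - proj pi (\<gamma> t)" "\<lambda>t. - (c * cos (\<psi> t - pi))"])
      (rule has_vector_derivative_minus, rule proj_deriv, use that in simp_all)
  then show ?thesis
    using c_nonneg a_pos by (cases "c = 0") (auto simp: proj_def start finish)
qed

lemma \<psi>_mono: "0 \<le> s \<Longrightarrow> s < t \<Longrightarrow> t \<le> 1 \<Longrightarrow> \<psi> s < \<psi> t"
  by (rule increasing_on_unit_interval[OF \<psi>_deriv])
    (use c_pos less_le_trans[OF m_pos k_ge] in auto)

lemma \<psi>_mono_le: "0 \<le> s \<Longrightarrow> s \<le> t \<Longrightarrow> t \<le> 1 \<Longrightarrow> \<psi> s \<le> \<psi> t"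
  using \<psi>_mono[of s t] by (cases "s = t") auto

lemma turning_le: "\<psi> 1 - \<psi> 0 \<le> c * M"
proof -
  have "c * M * 0 - \<psi> 0 \<le> c * M * 1 - \<psi> 1"
    by (rule nondecreasing_on_unit_interval[of "\<lambda>t. c * M * t - \<psi> t" "\<lambda>t. c * M * 1 - c * k (\<gamma> t, t)"])
      (rule has_vector_derivative_diff has_vector_derivative_mult_right has_vector_derivative_id
          \<psi>_deriv | use mult_left_mono[OF k_le c_nonneg] in simp)+
  then show ?thesis by simp
qed

text \<open>In terms of the angle, displacement is the integral of the cosine against the radius of
  curvature. It is smallest with radius \<open>1 / M\<close> where the cosine is positive and
  \<open>1 / m\<close> where it is negative.\<close>

lemma proj_ge_turning:
  assumes "0 \<le> s" "s \<le> t" "t \<le> 1"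
  shows "(cos_pos_integral (\<psi> t - \<eta>) - cos_pos_integral (\<psi> s - \<eta>)) / M
      - (cos_neg_integral (\<psi> t - \<eta>) - cos_neg_integral (\<psi> s - \<eta>)) / m
    \<le> proj \<eta> (\<gamma> t) - proj \<eta> (\<gamma> s)"
proof -
  let ?g = "\<lambda>x. cos_pos_integral (x - \<eta>) / M - cos_neg_integral (x - \<eta>) / m"
  let ?g' = "\<lambda>x. max 0 (cos (x - \<eta>)) / M - max 0 (- cos (x - \<eta>)) / m"
  have g: "(?g has_real_derivative ?g' x) (at x)" for x
  proof -
    have "((\<lambda>x. x - \<eta>) has_real_derivative 1) (at x)"
      by (auto intro!: derivative_eq_intros)
    from DERIV_diff[OF DERIV_cdivide[OF DERIV_chain2[OF DERIV_cos_pos_integral this]]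
        DERIV_cdivide[OF DERIV_chain2[OF DERIV_cos_neg_integral this]]]
    show ?thesis by simp
  qed
  have "proj \<eta> (\<gamma> s) - ?g (\<psi> s) \<le> proj \<eta> (\<gamma> t) - ?g (\<psi> t)"
  proof (rule nondecreasing_on_unit_interval[of "\<lambda>t. proj \<eta> (\<gamma> t) - ?g (\<psi> t)"
        "\<lambda>t. c * cos (\<psi> t - \<eta>) - ?g' (\<psi> t) * (c * k (\<gamma> t, t))", OF _ assms])
    fix x assume x: "s < x" "x < t"
    let ?u = "\<psi> x - \<eta>" and ?\<kappa> = "k (\<gamma> x, x)"
    have \<kappa>: "m \<le> ?\<kappa>" "?\<kappa> \<le> M" using x assms by (auto intro!: k_ge k_le)
    \<comment> \<open>Used for the positive part of the cosine with \<open>M\<close> and for the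
      negative part with \<open>m\<close>.\<close>
    have "p * ?\<kappa> / M \<le> p" "p \<le> p * ?\<kappa> / m" if "0 \<le> p" for p
      using that \<kappa> M_pos m_pos by (simp_all add: pos_divide_le_eq pos_le_divide_eq mult_left_mono)
    from this(1)[of "max 0 (cos ?u)"] this(2)[of "max 0 (- cos ?u)"]
    have "max 0 (cos ?u) * ?\<kappa> / M \<le> max 0 (cos ?u)" "max 0 (- cos ?u) \<le> max 0 (- cos ?u) * ?\<kappa> / m"
      by simp_all
    moreover have "cos ?u = max 0 (cos ?u) - max 0 (- cos ?u)" by auto
    ultimately have "0 \<le> cos ?u - (max 0 (cos ?u) * ?\<kappa> / M - max 0 (- cos ?u) * ?\<kappa> / m)" by linarith
    then have "0 \<le> c * (cos ?u - (max 0 (cos ?u) * ?\<kappa> / M - max 0 (- cos ?u) * ?\<kappa> / m))"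
      using c_nonneg by simp
    then show "0 \<le> c * cos (\<psi> x - \<eta>) - ?g' (\<psi> x) * (c * k (\<gamma> x, x))"
      by (simp add: algebra_simps)
  qed (intro has_vector_derivative_diff proj_deriv comp_\<psi>_deriv g)
  then show ?thesis by (simp add: diff_divide_distrib)
qed

text \<open>In the direction halfway between the two end tangents, every tangent strictly between
  them has a positive component, so the curve advances strictly.\<close>

lemma no_loop_turning_le_pi:
  assumes "0 \<le> s" "s < t" "t \<le> 1" "\<psi> t - \<psi> s \<le> pi"
  shows "\<gamma> s \<noteq> \<gamma> t"
proof -
  let ?\<eta> = "(\<psi> s + \<psi> t) / 2"
  have "proj ?\<eta> (\<gamma> s) < proj ?\<eta> (\<gamma> t)"
  proof (rule increasing_on_unit_interval[OF proj_deriv])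
    fix x assume "s < x" "x < t"
    with \<psi>_mono[of s x] \<psi>_mono[of x t] assms have "\<psi> s < \<psi> x" "\<psi> x < \<psi> t" by auto
    then show "0 < c * cos (\<psi> x - ?\<eta>)"
      using assms c_pos by (intro mult_pos_pos cos_gt_zero_pi) (auto simp: field_simps)
  qed (use assms in auto)
  then show ?thesis by auto
qed

lemma simple_if_turning_le_pi:
  assumes "\<psi> 1 - \<psi> 0 \<le> pi"
  shows "simple_curve \<gamma>"
proof -
  have "\<gamma> s \<noteq> \<gamma> t" if "0 \<le> s" "s < t" "t \<le> 1" for s t
    using that assms \<psi>_mono_le[of 0 s] \<psi>_mono_le[of t 1] by (intro no_loop_turning_le_pi) auto
  then show ?thesis
    unfolding simple_curve_def inj_on_def by (metis atLeastAtMost_iff linorder_neqE)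
qed

text \<open>A loop must turn so far that the rest of the curve lies within a small cone, and then its
  endpoints are closer together than \<open>2 * a\<close>.\<close>

lemma simple_if_turning_le_two_pi:
  assumes turn: "\<psi> 1 - \<psi> 0 \<le> 2*pi" and ratio: "1 / m < a + 1 / M"
  shows "simple_curve \<gamma>"
proof -
  have False if st: "0 \<le> s" "s < t" "t \<le> 1" and loop: "\<gamma> s = \<gamma> t" for s t
  proof -
    \<comment> \<open>Half the turning of the loop; seen from its mean direction the tangent runs
      from \<open>- b\<close> to \<open>b\<close>.\<close>
    define b where "b = (\<psi> t - \<psi> s) / 2"
    have b: "pi / 2 < b" "b \<le> pi"
      using no_loop_turning_le_pi[OF st] loop turn st \<psi>_mono_le[of 0 s] \<psi>_mono_le[of t 1]
      by (force simp: b_def)+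
    \<comment> \<open>The loop has zero displacement in its mean direction. It sweeps the whole
      positive arch, gaining at least \<open>2 / M\<close>, and loses at most
      \<open>(2 - 2 * sin b) / m\<close>.\<close>
    have sin_b: "sin b \<le> 1 - m / M"
    proof -
      have F: "cos_pos_integral b - cos_pos_integral (- b) = 2"
        using cos_pos_integral_half_pi[of b] cos_pos_integral_half_pi[of "- b + 2*pi"]
          cos_pos_integral_period[of "- b"] b by simp
      have "2 / M - (2 - 2 * sin b) / m \<le> 0"
      proof -
        have "\<psi> t - (\<psi> s + \<psi> t) / 2 = b" "\<psi> s - (\<psi> s + \<psi> t) / 2 = - b"
          by (simp_all add: b_def field_simps)
        moreover have "cos_neg_integral b - cos_neg_integral (- b) = 2 - 2 * sin b"
          using F by (simp add: cos_neg_integral_def)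
        ultimately show ?thesis
          using proj_ge_turning[of s t "(\<psi> s + \<psi> t) / 2"] st loop F by simp
      qed
      then show ?thesis using m_pos M_pos by (simp add: field_simps)
    qed
    \<comment> \<open>Together with \<open>ratio\<close> this gives \<open>m / M > 1 / 2\<close>, so
      the loop falls short of a full turn by less than pi/3.\<close>
    have "1 / M > a" using M_a M_pos by (simp add: field_simps)
    then have "1 / m < 2 / M" using ratio by simp
    then have "1 / 2 < m / M" using m_pos M_pos by (simp add: field_simps)
    then have "sin b < 1 / 2" using sin_b by linarith
    have b6: "pi - b < pi / 6"
    proof (rule ccontr)
      assume "\<not> ?thesis"
      then have "sin (pi / 6) \<le> sin (pi - b)" using b by (intro sin_monotone_2pi_le) auto
      then show False using \<open>sin b < 1 / 2\<close> by (simp add: sin_30)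
    qed
    \<comment> \<open>Modulo a full turn, all tangents outside the loop lie in this range of width
      below pi/3. Both remaining pieces thus advance in direction \<open>v\<close>, and the loop
      closes up, so the way from \<open>(a, 0)\<close> to \<open>(- a, 0)\<close> has a nonnegative
      component along \<open>v\<close>.\<close>
    have cone: "cos v \<le> 0" if v: "\<psi> t \<le> v" "v \<le> \<psi> s + 2*pi" for v
    proof -
      have near: "0 \<le> cos (\<psi> x - v)" if "x \<in> {0..1}" "x \<le> s \<or> t \<le> x" for x
        using that(2)
      proof
        assume "x \<le> s"
        then have "\<psi> 0 \<le> \<psi> x" "\<psi> x \<le> \<psi> s" "\<psi> t \<le> \<psi> 1"
          using that st by (auto intro!: \<psi>_mono_le)
        then have "0 \<le> cos ((\<psi> x - v) + 2*pi)"
          using v b6 turn by (intro cos_ge_zero) (auto simp: b_def)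
        then show ?thesis by simp
      next
        assume "t \<le> x"
        then have "\<psi> t \<le> \<psi> x" "\<psi> x \<le> \<psi> 1" "\<psi> 0 \<le> \<psi> s"
          using that st by (auto intro!: \<psi>_mono_le)
        then show ?thesis
          using v b6 turn by (intro cos_ge_zero) (auto simp: b_def)
      qed
      have "proj v (\<gamma> 0) \<le> proj v (\<gamma> s)" "proj v (\<gamma> t) \<le> proj v (\<gamma> 1)"
        using st c_nonneg near by (auto intro!: nondecreasing_on_unit_interval[OF proj_deriv])
      then have "a * cos v \<le> - a * cos v" by (simp add: loop proj_def start finish)
      then show ?thesis using a_pos by (simp add: mult_le_0_iff)
    qed
    \<comment> \<open>Outside the loop the first coordinate decreases, and by no more than on a
      circle of curvature \<open>m\<close> with the same turning.\<close>
    have tail: "fst (\<gamma> u) - sin (\<psi> u) / m \<le> fst (\<gamma> v) - sin (\<psi> v) / m"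
      if uv: "0 \<le> u" "u \<le> v" "v \<le> 1" "v \<le> s \<or> t \<le> u" for u v
    proof (rule nondecreasing_on_unit_interval[of "\<lambda>x. fst (\<gamma> x) - sin (\<psi> x) / m"
          "\<lambda>x. c * cos (\<psi> x) - cos (\<psi> x) / m * (c * k (\<gamma> x, x))", OF _ uv(1-3)])
      show "((\<lambda>x. fst (\<gamma> x) - sin (\<psi> x) / m) has_vector_derivative
          c * cos (\<psi> x) - cos (\<psi> x) / m * (c * k (\<gamma> x, x))) (at x within {0..1})" if "x \<in> {0..1}" for x
      proof (rule has_vector_derivative_diff)
        show "((\<lambda>x. fst (\<gamma> x)) has_vector_derivative c * cos (\<psi> x)) (at x within {0..1})"
          using bounded_linear.has_vector_derivative[OF bounded_linear_fst \<gamma>_deriv[OF that]] by simp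
        show "((\<lambda>x. sin (\<psi> x) / m) has_vector_derivative cos (\<psi> x) / m * (c * k (\<gamma> x, x))) (at x within {0..1})"
          by (rule comp_\<psi>_deriv[OF that, of "\<lambda>x. sin x / m"])
            (rule DERIV_cdivide[OF DERIV_sin])
      qed
      fix x assume x: "u < x" "x < v"
      have "cos (\<psi> x) \<le> 0"
        using uv(4)
      proof
        assume "v \<le> s"
        then have "\<psi> 0 \<le> \<psi> x" "\<psi> x \<le> \<psi> s" "\<psi> t \<le> \<psi> 1"
          using x uv st by (auto intro!: \<psi>_mono_le)
        then show ?thesis using cone[of "\<psi> x + 2*pi"] turn by simp
      next
        assume "t \<le> u"
        then have "\<psi> t \<le> \<psi> x" "\<psi> x \<le> \<psi> 1" "\<psi> 0 \<le> \<psi> s"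
          using x uv st by (auto intro!: \<psi>_mono_le)
        then show ?thesis using cone[of "\<psi> x"] turn by simp
      qed
      moreover have "1 - k (\<gamma> x, x) / m \<le> 0"
        using k_ge[of x "\<gamma> x"] x uv m_pos by simp
      ultimately have "0 \<le> c * (cos (\<psi> x) * (1 - k (\<gamma> x, x) / m))"
        using c_nonneg by (intro mult_nonneg_nonneg mult_nonpos_nonpos)
      then show "0 \<le> c * cos (\<psi> x) - cos (\<psi> x) / m * (c * k (\<gamma> x, x))"
        by (simp add: algebra_simps)
    qed
    \<comment> \<open>The angles missing from \<open>\<psi> 1\<close> to a full turn beyond
      \<open>\<psi> 0\<close> also lie in the cone, where the sine is nonincreasing.\<close>
    have gap: "sin (\<psi> 0) \<le> sin (\<psi> 1)"
    proof -
      have "- sin (\<psi> 1) \<le> - sin (\<psi> 0 + 2*pi)"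
      proof (rule DERIV_nonneg_imp_nondecreasing[of _ _ "\<lambda>x. - sin x"])
        show "\<psi> 1 \<le> \<psi> 0 + 2*pi" using turn by simp
        fix x assume "\<psi> 1 \<le> x" "x \<le> \<psi> 0 + 2*pi"
        with \<psi>_mono_le[of 0 s] \<psi>_mono_le[of t 1] st have "cos x \<le> 0" by (intro cone) auto
        then show "\<exists>y. ((\<lambda>x. - sin x) has_real_derivative y) (at x) \<and> 0 \<le> y"
          by (intro exI[of _ "- cos x"]) (auto intro!: derivative_eq_intros)
      qed
      then show ?thesis by simp
    qed
    \<comment> \<open>Sum of the two tail estimates; the positions at \<open>s\<close> and
      \<open>t\<close> cancel.\<close>
    have "2 * a \<le> (sin (\<psi> 0) - sin (\<psi> s) + (sin (\<psi> t) - sin (\<psi> 1))) / m"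
      using tail[of 0 s] tail[of t 1] st by (simp add: start finish loop add_divide_distrib diff_divide_distrib)
    also have "\<dots> \<le> (sin (\<psi> t) - sin (\<psi> s)) / m"
      using gap m_pos by (intro divide_right_mono) auto
    also have "\<dots> \<le> 2 * sin b / m"
    proof (intro divide_right_mono)
      have "sin (\<psi> t) - sin (\<psi> s) = 2 * sin b * cos ((\<psi> t + \<psi> s) / 2)"
        by (simp add: sin_diff_sin b_def)
      also have "\<dots> \<le> 2 * sin b * 1"
        using b by (intro mult_left_mono) (auto intro: sin_ge_zero)
      finally show "sin (\<psi> t) - sin (\<psi> s) \<le> 2 * sin b" by simp
    qed (use m_pos in simp)
    also have "\<dots> \<le> 2 * (1 - m / M) / m"
      using sin_b m_pos by (intro divide_right_mono) auto
    also have "\<dots> = 2 / m - 2 / M"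
      using m_pos M_pos by (simp add: field_simps)
    finally show False using ratio by simp
  qed
  then show ?thesis
    unfolding simple_curve_def inj_on_def by (metis atLeastAtMost_iff linorder_neqE)
qed

section \<open>Regularity and the second-order equation\<close>

lemma vderiv01_\<gamma>: "t \<in> {0..1} \<Longrightarrow> vderiv01 \<gamma> t = (c * cos (\<psi> t), c * sin (\<psi> t))"
  unfolding vderiv01_def by (rule vector_derivative_within_closed_interval[OF _ _ \<gamma>_deriv]) auto

lemma vderiv01_\<gamma>_deriv:
  assumes "t \<in> {0..1}"
  shows "(vderiv01 \<gamma> has_vector_derivative
    (- (c * sin (\<psi> t) * (c * k (\<gamma> t, t))), c * cos (\<psi> t) * (c * k (\<gamma> t, t)))) (at t within {0..1})"
proof (rule has_vector_derivative_transform[OF assms])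
  show "((\<lambda>t. (c * cos (\<psi> t), c * sin (\<psi> t))) has_vector_derivative
    (- (c * sin (\<psi> t) * (c * k (\<gamma> t, t))), c * cos (\<psi> t) * (c * k (\<gamma> t, t)))) (at t within {0..1})"
  proof (rule has_vector_derivative_Pair)
    have "((\<lambda>x. c * cos x) has_real_derivative - (c * sin x)) (at x)"
      "((\<lambda>x. c * sin x) has_real_derivative c * cos x) (at x)" for x
      by (auto intro!: derivative_eq_intros)
    from this[THEN comp_\<psi>_deriv[OF assms]]
    show "((\<lambda>t. c * cos (\<psi> t)) has_vector_derivative - (c * sin (\<psi> t) * (c * k (\<gamma> t, t)))) (at t within {0..1})"
      "((\<lambda>t. c * sin (\<psi> t)) has_vector_derivative c * cos (\<psi> t) * (c * k (\<gamma> t, t))) (at t within {0..1})"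
      by simp_all
  qed
qed (simp add: vderiv01_\<gamma>)

lemma vderiv01_vderiv01_\<gamma>: "t \<in> {0..1} \<Longrightarrow> vderiv01 (vderiv01 \<gamma>) t =
    (- (c * sin (\<psi> t) * (c * k (\<gamma> t, t))), c * cos (\<psi> t) * (c * k (\<gamma> t, t)))"
  unfolding vderiv01_def[of "vderiv01 \<gamma>"]
  by (rule vector_derivative_within_closed_interval[OF _ _ vderiv01_\<gamma>_deriv]) auto

lemma speed: "t \<in> {0..1} \<Longrightarrow> norm (vderiv01 \<gamma> t) = c"
proof -
  have "(c * cos (\<psi> t))\<^sup>2 + (c * sin (\<psi> t))\<^sup>2 = c\<^sup>2"
    by (simp add: power_mult_distrib flip: distrib_left)
  then show "t \<in> {0..1} \<Longrightarrow> norm (vderiv01 \<gamma> t) = c"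
    using c_nonneg by (simp add: vderiv01_\<gamma> norm_Pair)
qed

lemma bvp_solution: "bvp_solution a k \<gamma>"
  unfolding bvp_solution_def C2_on01_def
proof (intro conjI ballI)
  show "\<gamma> differentiable_on {0..1}" "vderiv01 \<gamma> differentiable_on {0..1}"
    unfolding differentiable_on_def using \<gamma>_deriv vderiv01_\<gamma>_deriv by (meson differentiableI_vector)+
  have "continuous_on {0..1} (\<lambda>t. (- (c * sin (\<psi> t) * (c * k (\<gamma> t, t))), c * cos (\<psi> t) * (c * k (\<gamma> t, t))))"
    by (intro continuous_intros \<psi>_cont continuous_on_compose2[OF k_cont] \<gamma>_cont) auto
  then show "continuous_on {0..1} (vderiv01 (vderiv01 \<gamma>))"
    by (rule continuous_on_eq) (simp add: vderiv01_vderiv01_\<gamma>)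
  show "vderiv01 (vderiv01 \<gamma>) t = (norm (vderiv01 \<gamma> t) * k (\<gamma> t, t)) *\<^sub>R J (vderiv01 \<gamma> t)"
    if "t \<in> {0..1}" for t
    using that by (simp add: speed vderiv01_vderiv01_\<gamma>) (simp add: vderiv01_\<gamma> J_def)
qed (use start finish in auto)

end

section \<open>Existence of the short and the long solution\<close>

context curvature begin

lemma shooting:
  assumes c0: "0 \<le> c0" and c1: "0 \<le> c1" "c1 * M \<le> pi" "a < sin (c1 * M / 2) / M"
    and end0: "\<And>n \<theta>. 0 < n \<Longrightarrow> - a < fst (pos n \<theta> c0 n)"
    and not_stopped: "\<And>n \<theta> c. \<lbrakk>0 < n; c \<in> closed_segment c0 c1; pos n \<theta> c n = (- a, 0)\<rbrakk>
      \<Longrightarrow> ang n \<theta> c n < \<theta> + 2*pi"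
  obtains c \<gamma> \<psi> where "c \<in> closed_segment c0 c1" "curvature_solution a m M k c \<gamma> \<psi>" "\<psi> 1 - \<psi> 0 \<le> 2*pi"
proof -
  \<comment> \<open>Even and positive, so that the middle of the curve is a grid point.\<close>
  define n where "n i = 2 * Suc i" for i :: nat
  have n: "0 < n i" for i by (simp add: n_def)
  have "\<exists>\<theta>\<in>{0..2*pi}. \<exists>c\<in>closed_segment c0 c1. pos (n i) \<theta> c (n i) = (- a, 0)" for i
    by (rule discrete_shooting[OF c0 c1, of _ "Suc i"]) (use end0[OF n] in \<open>auto simp: n_def\<close>)
  then obtain \<theta> c where sol: "\<And>i. \<theta> i \<in> {0..2*pi}" "\<And>i. c i \<in> closed_segment c0 c1"
    "\<And>i. pos (n i) (\<theta> i) (c i) (n i) = (- a, 0)" by metis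
  have seg: "closed_segment c0 c1 = {min c0 c1..max c0 c1}"
    by (auto simp: closed_segment_eq_real_ivl)
  have lim: "filterlim n at_top sequentially"
    unfolding n_def by (rule filterlim_subseq) (simp add: strict_mono_def)
  obtain C \<gamma> \<psi> where "C \<in> {min c0 c1..max c0 c1}"
    "\<And>t. t \<in> {0..1} \<Longrightarrow>
      ((\<lambda>t. (\<gamma> t, \<psi> t)) has_vector_derivative velocity ((\<gamma> t, \<psi> t), t, C)) (at t within {0..1})"
    "\<gamma> 0 = (a, 0)" "\<gamma> 1 = (- a, 0)" "\<psi> 1 - \<psi> 0 \<le> 2*pi"
    by (rule limit_solution[OF lim n sol(1) sol(2)[unfolded seg] _ not_stopped[OF n sol(2,3)] sol(3)])
      (use c0 c1 in auto)
  moreover from this have "curvature_solution a m M k C \<gamma> \<psi>"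
    using c0 c1 by unfold_locales auto
  ultimately show thesis
    using that by (auto simp: seg)
qed

text \<open>Shooting starts from speed 0. Up to \<open>pi / M\<close> the total turning is at most
  pi, which rules out both a cut and a loop.\<close>

lemma short_solution:
  obtains c \<gamma> \<psi> where "c < pi / M" "curvature_solution a m M k c \<gamma> \<psi>" "simple_curve \<gamma>"
proof -
  \<comment> \<open>Any value strictly between \<open>arcsin (a * M)\<close> and pi/2 would do: the
    lower bound makes the chord long enough, the upper one keeps the speed strictly below
    \<open>pi / M\<close>.\<close>
  define y where "y = (arcsin (a * M) + pi / 2) / 2"
  have aM: "0 < a * M" "a * M < 1" using a_pos M_pos M_a by (auto simp: mult.commute)
  then have "- (pi / 2) < arcsin (a * M)" "arcsin (a * M) < pi / 2"
    using arcsin_lt_bounded[of "a * M"] by auto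
  then have y: "0 < y" "y < pi / 2" "arcsin (a * M) < y" by (auto simp: y_def)
  have "sin (arcsin (a * M)) < sin y"
    using y aM arcsin_lt_bounded[of "a * M"] by (intro sin_monotone_2pi) auto
  then have sin_y: "a * M < sin y" using aM by simp
  define c1 where "c1 = 2 * y / M"
  have c1: "0 \<le> c1" "c1 * M \<le> pi" "a < sin (c1 * M / 2) / M" "c1 < pi / M"
    using y sin_y M_pos by (auto simp: c1_def field_simps)
  have still: "pos n \<theta> 0 j = (a, 0)" if "j \<le> n" for n \<theta> j
    using that
  proof (induction j)
    case (Suc j)
    then show ?case
      using ang_step(1,2)[of 0 j n \<theta>] by (simp add: pos_Suc zero_prod_def[symmetric])
  qed (simp add: pos_0)
  have le: "c * M \<le> pi" if "c \<in> closed_segment 0 c1" for c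
  proof -
    have "c * M \<le> c1 * M"
      using that c1(1) M_pos by (intro mult_right_mono) (auto simp: closed_segment_eq_real_ivl)
    with c1(2) show ?thesis by linarith
  qed
  obtain c \<gamma> \<psi> where c: "c \<in> closed_segment 0 c1" and sol: "curvature_solution a m M k c \<gamma> \<psi>"
  proof (rule shooting[of 0 c1])
    show "- a < fst (pos n \<theta> 0 n)" for n \<theta> using still a_pos by simp
    show "ang n \<theta> c n < \<theta> + 2*pi" if "0 < n" "c \<in> closed_segment 0 c1" for n \<theta> c
    proof -
      have "ang n \<theta> c n - ang n \<theta> c 0 \<le> c * M"
        using ang_diff_le[of c 0 n n \<theta>] that c1 by (auto simp: closed_segment_eq_real_ivl)
      with le[OF that(2)] show ?thesis using pi_gt_zero unfolding ang_0 by linarith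
    qed
  qed (use c1 in auto)
  interpret sol: curvature_solution a m M k c \<gamma> \<psi> by fact
  have "simple_curve \<gamma>"
    using sol.turning_le le[OF c] by (intro sol.simple_if_turning_le_pi) linarith
  moreover have "c < pi / M" using c c1 by (auto simp: closed_segment_eq_real_ivl)
  ultimately show thesis using sol that by blast
qed

text \<open>Shooting runs between \<open>2*pi / m\<close>, where every curve is stopped after a full
  turn and its chord is too short, and \<open>pi / M\<close>. A curve that hits the target cannot
  have been stopped, for the same reason.\<close>

lemma long_solution:
  assumes ratio: "1 / m < a + 1 / M"
  obtains c \<gamma> \<psi> where "pi / M \<le> c" "curvature_solution a m M k c \<gamma> \<psi>" "simple_curve \<gamma>"
proof -
  have seg: "closed_segment (2*pi / m) (pi / M) = {pi / M..2*pi / m}"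
  proof -
    have "pi / M \<le> 2*pi / m" using m_pos m_le_M by (intro frac_le) auto
    then show ?thesis by (auto simp: closed_segment_eq_real_ivl)
  qed
  \<comment> \<open>Projection to the direction pi: a stopped curve has moved left by at most
    \<open>2 / m - 2 / M\<close>, which is less than \<open>2 * a\<close>.\<close>
  have full: "a - 2 * a < fst (pos n \<theta> c n)" if "0 \<le> c" "ang n \<theta> c n = \<theta> + 2*pi" for n \<theta> c
    using proj_stopped_le[OF that, of pi] ratio by (simp add: proj_def)
  have aM: "a * M < 1" using M_a by (simp add: mult.commute)
  obtain c \<gamma> \<psi> where c: "c \<in> closed_segment (2*pi / m) (pi / M)"
    and sol: "curvature_solution a m M k c \<gamma> \<psi>" and turn: "\<psi> 1 - \<psi> 0 \<le> 2*pi"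
  proof (rule shooting[of "2*pi / m" "pi / M"])
    show "a < sin (pi / M * M / 2) / M" using aM M_pos by (simp add: field_simps)
    show "- a < fst (pos n \<theta> (2*pi / m) n)" if "0 < n" for n \<theta>
      using full[OF _ ang_stopped[OF _ that]] m_pos by simp
    show "ang n \<theta> c n < \<theta> + 2*pi"
      if "c \<in> closed_segment (2*pi / m) (pi / M)" "pos n \<theta> c n = (- a, 0)" for n \<theta> c
    proof -
      have "0 \<le> pi / M" using M_pos by simp
      with that(1) seg have "0 \<le> c" by auto
      with full[of c n \<theta>] that(2) ang_le[of n \<theta> c n] show ?thesis by force
    qed
  qed (use m_pos M_pos in auto)
  interpret sol: curvature_solution a m M k c \<gamma> \<psi> by fact
  have "simple_curve \<gamma>" by (rule sol.simple_if_turning_le_two_pi[OF turn ratio])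
  then show thesis using sol that c seg by auto
qed

end

theorem theorem1p1:
  fixes a :: real and k :: "(real \<times> real) \<times> real \<Rightarrow> real"
  assumes "a > 0"
    and "continuous_on (UNIV \<times> {0..1}) k"
    and "bdd_below (k ` (UNIV \<times> {0..1}))" and "bdd_above (k ` (UNIV \<times> {0..1}))"
    and "0 < (INF z\<in>UNIV \<times> {0..1}. k z)"
    and "(INF z\<in>UNIV \<times> {0..1}. k z) \<le> (SUP z\<in>UNIV \<times> {0..1}. k z)"
    and "(SUP z\<in>UNIV \<times> {0..1}. k z) < inverse a"
  shows "(\<exists>\<gamma>. bvp_solution a k \<gamma> \<and> simple_curve \<gamma>) \<and>
    ((SUP z\<in>UNIV \<times> {0..1}. k z) / ((SUP z\<in>UNIV \<times> {0..1}. k z) * a + 1)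
        < (INF z\<in>UNIV \<times> {0..1}. k z) \<longrightarrow>
     (\<exists>\<gamma>\<^sub>1 \<gamma>\<^sub>2. bvp_solution a k \<gamma>\<^sub>1 \<and> simple_curve \<gamma>\<^sub>1 \<and>
        bvp_solution a k \<gamma>\<^sub>2 \<and> simple_curve \<gamma>\<^sub>2 \<and>
        (\<exists>t\<in>{0..1}. \<gamma>\<^sub>1 t \<noteq> \<gamma>\<^sub>2 t)))"
proof -
  define m M where "m = (INF z\<in>UNIV \<times> {0..1}. k z)" and "M = (SUP z\<in>UNIV \<times> {0..1}. k z)"
  interpret curvature a m M k
  proof
    show "m \<le> k (p, t)" "k (p, t) \<le> M" if "t \<in> {0..1}" for p t
      unfolding m_def M_def using assms(3,4) that by (auto intro!: cINF_lower cSUP_upper)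
    show "M * a < 1" using assms(1,7) by (simp add: M_def field_simps)
  qed (use assms in \<open>simp_all add: m_def\<close>)
  obtain c1 \<gamma>1 \<psi>1 where c1: "c1 < pi / M" and "curvature_solution a m M k c1 \<gamma>1 \<psi>1"
    and simple1: "simple_curve \<gamma>1"
    by (rule short_solution)
  then interpret s1: curvature_solution a m M k c1 \<gamma>1 \<psi>1 by simp
  have "\<exists>\<gamma>\<^sub>1 \<gamma>\<^sub>2. bvp_solution a k \<gamma>\<^sub>1 \<and> simple_curve \<gamma>\<^sub>1 \<and>
        bvp_solution a k \<gamma>\<^sub>2 \<and> simple_curve \<gamma>\<^sub>2 \<and> (\<exists>t\<in>{0..1}. \<gamma>\<^sub>1 t \<noteq> \<gamma>\<^sub>2 t)"
    if "M / (M * a + 1) < m"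
  proof -
    have "0 < M * a + 1" using M_pos a_pos by (simp add: add_pos_pos)
    \<comment> \<open>The second hypothesis, after taking reciprocals.\<close>
    then have "1 / m < a + 1 / M" using that m_pos M_pos by (simp add: field_simps)
    then obtain c2 \<gamma>2 \<psi>2 where c2: "pi / M \<le> c2" and "curvature_solution a m M k c2 \<gamma>2 \<psi>2"
      and simple2: "simple_curve \<gamma>2"
      by (rule long_solution)
    then interpret s2: curvature_solution a m M k c2 \<gamma>2 \<psi>2 by simp
    \<comment> \<open>Curves that agree on the interval have the same initial velocity, hence equal
      speeds, but the speeds are separated by \<open>pi / M\<close>.\<close>
    have "\<exists>t\<in>{0..1}. \<gamma>1 t \<noteq> \<gamma>2 t"
    proof (rule ccontr)
      assume "\<not> ?thesis"
      then have "(\<gamma>2 has_vector_derivative vderiv01 \<gamma>1 0) (at 0 within {0..1})"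
        using s1.\<gamma>_deriv[of 0] by (intro has_vector_derivative_transform[of 0 "{0..1}" \<gamma>2 \<gamma>1])
          (auto simp: s1.vderiv01_\<gamma>)
      then have "vderiv01 \<gamma>2 0 = vderiv01 \<gamma>1 0"
        unfolding vderiv01_def[of \<gamma>2] by (intro vector_derivative_within_closed_interval) auto
      then show False using s1.speed[of 0] s2.speed[of 0] c1 c2 by simp
    qed
    with simple1 simple2 s1.bvp_solution s2.bvp_solution show ?thesis by blast
  qed
  with simple1 s1.bvp_solution show ?thesis unfolding m_def M_def by blast
qed

end
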